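(* Let $(M,g)$ be an $n$-dimensional ($n>3$) weakly $Z$ symmetric manifold $(WZS)_n$ with $\eta_k\neq 0$ and harmonic conformal curvature tensor, $\nabla_m C_{jkl}{}^m=0$. If $$\eta_j\nabla_k\phi-\eta_k\nabla_j\phi=0,$$ then $\eta_i/\|\eta\|$ is a proper concircular vector.
   Context: $(M,g)$ is an $n$-dimensional Riemannian manifold with Levi-Civita connection $\nabla$; index notation with summation over repeated indices; $R_{jkl}{}^m$ is the Riemann tensor, $R_{kl}=-R_{mkl}{}^m$ the Ricci tensor, $R=g^{ij}R_{ij}$ the scalar curvature. Generalized $Z$ tensor: $Z_{kl}=R_{kl}+\phi\,g_{kl}$, where $\phi$ is an arbitrary scalar function. The manifold is weakly $Z$ symmetric, $(WZS)_n$, if for some $\phi$ there are covectors $A_k,B_k,D_k$ with $$\nabla_kZ_{jl}=A_kZ_{jl}+B_jZ_{kl}+D_lZ_{kj}.$$ Put $\eta_k=B_k-D_k$ and $\|\eta\|=\sqrt{\eta^k\eta_k}$; the hypothesis $\eta_k\ne0$ is understood pointwise. Conformal curvature tensor: $$C_{jkl}{}^m=R_{jkl}{}^m+\tfrac{1}{n-2}(\delta_j{}^mR_{kl}-\delta_k{}^mR_{jl}+R_j{}^mg_{kl}-R_k{}^mg_{jl})-\tfrac{R}{(n-1)(n-2)}(\delta_j{}^mg_{kl}-\delta_k{}^mg_{jl}).$$ A covector $X_l$ is concircular if $\nabla_jX_l=\mu_jX_l+\rho\,g_{jl}$ for some covector $\mu_j$ and scalar function $\rho$; it is proper concircular if moreover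 $\mu_j$ is a closed 1-form ($\nabla_i\mu_j=\nabla_j\mu_i$). For a unit covector $T_l$ this means $\nabla_jT_l=f(T_jT_l-g_{jl})$ for a scalar function $f$ with $fT_k$ closed.
   Formalization: The tensor Z is additionally assumed not to vanish identically on any connected component of M; if Z = 0 (e.g. flat space with φ = 0) the covectors A, B, D are arbitrary and the claim fails. *)

theory Defs
  imports "HOL-Analysis.Analysis"
begin

text \<open>
  The manifold is the whole type \<open>'a\<close> (Hausdorff and second countable by its type classes)
  together with a smooth atlas modelled on \<open>real ^ 'n\<close>, so its dimension is \<open>CARD('n)\<close>.
  Tensor fields are given, as in index notation, by their components in each chart of the atlas;
  the components are functions of the point of the manifold, they are only meaningful at points
  of the domain of the chart, and the components in different charts are related by the usual
  transformation law.
\<close>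

section \<open>Smooth functions, charts and atlases\<close>

definition partial_deriv :: "'n::finite \<Rightarrow> (real ^ 'n \<Rightarrow> real) \<Rightarrow> real ^ 'n \<Rightarrow> real" where
  "partial_deriv i f u = frechet_derivative f (at u) (axis i 1)"

primrec Ck_on :: "nat \<Rightarrow> (real ^ 'n::finite) set \<Rightarrow> (real ^ 'n \<Rightarrow> real) \<Rightarrow> bool" where
  "Ck_on 0 U f \<longleftrightarrow> continuous_on U f"
| "Ck_on (Suc k) U f \<longleftrightarrow>
     (\<forall>u\<in>U. f differentiable (at u)) \<and> (\<forall>i. Ck_on k U (partial_deriv i f))"

text \<open>Only used for open \<open>U\<close>.\<close>
definition smooth_on :: "(real ^ 'n::finite) set \<Rightarrow> (real ^ 'n \<Rightarrow> real) \<Rightarrow> bool" where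
  "smooth_on U f \<longleftrightarrow> (\<forall>k. Ck_on k U f)"

text \<open>A chart is a pair of its domain and its coordinate map; the values of the coordinate map
  outside the domain are irrelevant.\<close>
type_synonym ('a, 'n) chart = "'a set \<times> ('a \<Rightarrow> real ^ 'n)"

abbreviation dom_chart :: "('a, 'n::finite) chart \<Rightarrow> 'a set" where
  "dom_chart c \<equiv> fst c"

abbreviation coords :: "('a, 'n::finite) chart \<Rightarrow> 'a \<Rightarrow> real ^ 'n" where
  "coords c \<equiv> snd c"

definition chart_inv :: "('a, 'n::finite) chart \<Rightarrow> real ^ 'n \<Rightarrow> 'a" where
  "chart_inv c = inv_into (dom_chart c) (coords c)"

definition is_chart :: "('a::topological_space, 'n::finite) chart \<Rightarrow> bool" where
  "is_chart c \<longleftrightarrow> open (dom_chart c) \<and> open (coords c ` dom_chart c) \<and>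
     homeomorphism (dom_chart c) (coords c ` dom_chart c) (coords c) (chart_inv c)"

definition smooth_in_chart :: "('a, 'n::finite) chart \<Rightarrow> 'a set \<Rightarrow> ('a \<Rightarrow> real) \<Rightarrow> bool" where
  "smooth_in_chart c W f \<longleftrightarrow> smooth_on (coords c ` W) (f \<circ> chart_inv c)"

definition smooth_atlas ::
  "('a::{t2_space, second_countable_topology}, 'n::finite) chart set \<Rightarrow> bool" where
  "smooth_atlas atlas \<longleftrightarrow>
     (\<forall>c\<in>atlas. is_chart c) \<and>
     (\<Union>c\<in>atlas. dom_chart c) = UNIV \<and>
     (\<forall>c\<in>atlas. \<forall>d\<in>atlas. \<forall>i.
        smooth_in_chart c (dom_chart c \<inter> dom_chart d) (\<lambda>q. coords d q $ i))"

text \<open>The partial derivative of a function on the manifold with respect to the \<open>i\<close>-th coordinate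
  of the chart \<open>c\<close>, at the point \<open>p\<close>.\<close>
definition coord_deriv ::
  "('a, 'n::finite) chart \<Rightarrow> 'n \<Rightarrow> ('a \<Rightarrow> real) \<Rightarrow> 'a \<Rightarrow> real" where
  "coord_deriv c i f p = partial_deriv i (f \<circ> chart_inv c) (coords c p)"

section \<open>Tensor fields\<close>

type_synonym ('a, 'n) covector = "('a, 'n) chart \<Rightarrow> 'a \<Rightarrow> 'n \<Rightarrow> real"
type_synonym ('a, 'n) tensor02 = "('a, 'n) chart \<Rightarrow> 'a \<Rightarrow> 'n \<Rightarrow> 'n \<Rightarrow> real"
type_synonym ('a, 'n) tensor31 = "('a, 'n) chart \<Rightarrow> 'a \<Rightarrow> 'n \<Rightarrow> 'n \<Rightarrow> 'n \<Rightarrow> 'n \<Rightarrow> real"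

definition smooth_scalar_field :: "('a, 'n::finite) chart set \<Rightarrow> ('a \<Rightarrow> real) \<Rightarrow> bool" where
  "smooth_scalar_field atlas f \<longleftrightarrow> (\<forall>c\<in>atlas. smooth_in_chart c (dom_chart c) f)"

definition smooth_covector_field ::
  "('a, 'n::finite) chart set \<Rightarrow> ('a, 'n) covector \<Rightarrow> bool" where
  "smooth_covector_field atlas X \<longleftrightarrow>
     (\<forall>c\<in>atlas. \<forall>j. smooth_in_chart c (dom_chart c) (\<lambda>p. X c p j)) \<and>
     (\<forall>c\<in>atlas. \<forall>d\<in>atlas. \<forall>p \<in> dom_chart c \<inter> dom_chart d. \<forall>j.
        X c p j = (\<Sum>a\<in>UNIV. coord_deriv c j (\<lambda>q. coords d q $ a) p * X d p a))"

definition smooth_tensor02_field ::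
  "('a, 'n::finite) chart set \<Rightarrow> ('a, 'n) tensor02 \<Rightarrow> bool" where
  "smooth_tensor02_field atlas T \<longleftrightarrow>
     (\<forall>c\<in>atlas. \<forall>j l. smooth_in_chart c (dom_chart c) (\<lambda>p. T c p j l)) \<and>
     (\<forall>c\<in>atlas. \<forall>d\<in>atlas. \<forall>p \<in> dom_chart c \<inter> dom_chart d. \<forall>j l.
        T c p j l = (\<Sum>a\<in>UNIV. \<Sum>b\<in>UNIV.
          coord_deriv c j (\<lambda>q. coords d q $ a) p * coord_deriv c l (\<lambda>q. coords d q $ b) p
            * T d p a b))"

text \<open>\<open>T\<close> does not vanish identically on any connected component of the manifold; on a connected
  manifold this says that \<open>T\<close> is not the zero tensor field. This is needed for the Z tensor: if it
  vanishes identically (an Einstein metric), the weak Z symmetry equation holds for arbitrary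
  covectors and says nothing about them.\<close>
definition nonzero_on_components ::
  "('a::topological_space, 'n::finite) chart set \<Rightarrow> ('a, 'n) tensor02 \<Rightarrow> bool" where
  "nonzero_on_components atlas T \<longleftrightarrow>
     (\<forall>p. \<exists>q \<in> connected_component_set UNIV p. \<exists>c\<in>atlas. q \<in> dom_chart c \<and>
        (\<exists>k l. T c q k l \<noteq> 0))"

section \<open>Riemannian metric and Levi-Civita connection\<close>

definition riemannian_metric ::
  "('a, 'n::finite) chart set \<Rightarrow> ('a, 'n) tensor02 \<Rightarrow> bool" where
  "riemannian_metric atlas g \<longleftrightarrow> smooth_tensor02_field atlas g \<and>
     (\<forall>c\<in>atlas. \<forall>p \<in> dom_chart c.
        (\<forall>i j. g c p i j = g c p j i) \<and>
        (\<forall>v :: real ^ 'n. v \<noteq> 0 \<longrightarrow> (\<Sum>i\<in>UNIV. \<Sum>j\<in>UNIV. g c p i j * v $ i * v $ j) > 0))"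

text \<open>The components \<open>g\<^sup>i\<^sup>j\<close> of the inverse metric.\<close>
definition inv_metric :: "('a, 'n::finite) tensor02 \<Rightarrow> ('a, 'n) tensor02" where
  "inv_metric g c p i j = matrix_inv (\<chi> a b. g c p a b) $ i $ j"

text \<open>\<open>christoffel g c p k i j\<close> is \<open>\<Gamma>\<^sup>k\<^sub>i\<^sub>j\<close>.\<close>
definition christoffel ::
  "('a, 'n::finite) tensor02 \<Rightarrow> ('a, 'n) chart \<Rightarrow> 'a \<Rightarrow> 'n \<Rightarrow> 'n \<Rightarrow> 'n \<Rightarrow> real" where
  "christoffel g c p k i j = (1/2) * (\<Sum>m\<in>UNIV. inv_metric g c p k m *
     (coord_deriv c i (\<lambda>q. g c q j m) p + coord_deriv c j (\<lambda>q. g c q i m) p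
      - coord_deriv c m (\<lambda>q. g c q i j) p))"

text \<open>In the covariant derivatives the first index is the index of the derivative:
  \<open>\<nabla>\<^sub>k X\<^sub>l\<close>, \<open>\<nabla>\<^sub>k T\<^sub>j\<^sub>l\<close> and, for a tensor with components \<open>C\<^sub>j\<^sub>k\<^sub>l\<^sup>m\<close>,
  \<open>\<nabla>\<^sub>i C\<^sub>j\<^sub>k\<^sub>l\<^sup>m\<close>.\<close>
definition nabla_covector ::
  "('a, 'n::finite) tensor02 \<Rightarrow> ('a, 'n) covector \<Rightarrow> ('a, 'n) tensor02" where
  "nabla_covector g X c p k l =
     coord_deriv c k (\<lambda>q. X c q l) p - (\<Sum>s\<in>UNIV. christoffel g c p s k l * X c p s)"

definition nabla_tensor02 ::
  "('a, 'n::finite) tensor02 \<Rightarrow> ('a, 'n) tensor02 \<Rightarrow>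
   ('a, 'n) chart \<Rightarrow> 'a \<Rightarrow> 'n \<Rightarrow> 'n \<Rightarrow> 'n \<Rightarrow> real" where
  "nabla_tensor02 g T c p k j l =
     coord_deriv c k (\<lambda>q. T c q j l) p
     - (\<Sum>s\<in>UNIV. christoffel g c p s k j * T c p s l)
     - (\<Sum>s\<in>UNIV. christoffel g c p s k l * T c p j s)"

definition nabla_tensor31 ::
  "('a, 'n::finite) tensor02 \<Rightarrow> ('a, 'n) tensor31 \<Rightarrow>
   ('a, 'n) chart \<Rightarrow> 'a \<Rightarrow> 'n \<Rightarrow> 'n \<Rightarrow> 'n \<Rightarrow> 'n \<Rightarrow> 'n \<Rightarrow> real" where
  "nabla_tensor31 g C c p i j k l m =
     coord_deriv c i (\<lambda>q. C c q j k l m) p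
     - (\<Sum>s\<in>UNIV. christoffel g c p s i j * C c p s k l m)
     - (\<Sum>s\<in>UNIV. christoffel g c p s i k * C c p j s l m)
     - (\<Sum>s\<in>UNIV. christoffel g c p s i l * C c p j k s m)
     + (\<Sum>s\<in>UNIV. christoffel g c p m i s * C c p j k l s)"

section \<open>Curvature\<close>

text \<open>\<open>riemann g c p j k l m\<close> is \<open>R\<^sub>j\<^sub>k\<^sub>l\<^sup>m\<close>, with the sign convention
  \<open>\<nabla>\<^sub>j \<nabla>\<^sub>k X\<^sub>l - \<nabla>\<^sub>k \<nabla>\<^sub>j X\<^sub>l = R\<^sub>j\<^sub>k\<^sub>l\<^sup>m X\<^sub>m\<close>; with the minus sign in
  the definition of the Ricci tensor, round spheres have positive Ricci curvature.\<close>
definition riemann :: "('a, 'n::finite) tensor02 \<Rightarrow> ('a, 'n) tensor31" where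
  "riemann g c p j k l m =
     coord_deriv c k (\<lambda>q. christoffel g c q m j l) p
     - coord_deriv c j (\<lambda>q. christoffel g c q m k l) p
     + (\<Sum>s\<in>UNIV. christoffel g c p s j l * christoffel g c p m k s)
     - (\<Sum>s\<in>UNIV. christoffel g c p s k l * christoffel g c p m j s)"

definition ricci :: "('a, 'n::finite) tensor02 \<Rightarrow> ('a, 'n) tensor02" where
  "ricci g c p k l = - (\<Sum>m\<in>UNIV. riemann g c p m k l m)"

definition scalar_curv ::
  "('a, 'n::finite) tensor02 \<Rightarrow> ('a, 'n) chart \<Rightarrow> 'a \<Rightarrow> real" where
  "scalar_curv g c p = (\<Sum>i\<in>UNIV. \<Sum>j\<in>UNIV. inv_metric g c p i j * ricci g c p i j)"

definition kronecker :: "'n \<Rightarrow> 'n \<Rightarrow> real" where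
  "kronecker i j = (if i = j then 1 else 0)"

text \<open>\<open>ricci_mixed g c p j m\<close> is \<open>R\<^sub>j\<^sup>m\<close>.\<close>
definition ricci_mixed :: "('a, 'n::finite) tensor02 \<Rightarrow> ('a, 'n) tensor02" where
  "ricci_mixed g c p j m = (\<Sum>s\<in>UNIV. inv_metric g c p m s * ricci g c p j s)"

definition conformal_curv :: "('a, 'n::finite) tensor02 \<Rightarrow> ('a, 'n) tensor31" where
  "conformal_curv g c p j k l m = (let n = real CARD('n) in
     riemann g c p j k l m
     + 1 / (n - 2) *
         (kronecker j m * ricci g c p k l - kronecker k m * ricci g c p j l
          + ricci_mixed g c p j m * g c p k l - ricci_mixed g c p k m * g c p j l)
     - scalar_curv g c p / ((n - 1) * (n - 2)) *
         (kronecker j m * g c p k l - kronecker k m * g c p j l))"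

definition harmonic_conformal_curv ::
  "('a, 'n::finite) chart set \<Rightarrow> ('a, 'n) tensor02 \<Rightarrow> bool" where
  "harmonic_conformal_curv atlas g \<longleftrightarrow>
     (\<forall>c\<in>atlas. \<forall>p \<in> dom_chart c. \<forall>j k l.
        (\<Sum>m\<in>UNIV. nabla_tensor31 g (conformal_curv g) c p m j k l m) = 0)"

section \<open>Weakly Z symmetric manifolds and concircular covectors\<close>

definition Z_tensor ::
  "('a, 'n::finite) tensor02 \<Rightarrow> ('a \<Rightarrow> real) \<Rightarrow> ('a, 'n) tensor02" where
  "Z_tensor g \<phi> c p k l = ricci g c p k l + \<phi> p * g c p k l"

text \<open>The manifold is weakly Z symmetric, as witnessed by the scalar function \<open>\<phi>\<close> and the
  covectors \<open>A\<close>, \<open>B\<close>, \<open>D\<close>.\<close>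
definition weakly_Z_symmetric ::
  "('a, 'n::finite) chart set \<Rightarrow> ('a, 'n) tensor02 \<Rightarrow> ('a \<Rightarrow> real) \<Rightarrow>
   ('a, 'n) covector \<Rightarrow> ('a, 'n) covector \<Rightarrow> ('a, 'n) covector \<Rightarrow> bool" where
  "weakly_Z_symmetric atlas g \<phi> A B D \<longleftrightarrow>
     smooth_scalar_field atlas \<phi> \<and> smooth_covector_field atlas A \<and>
     smooth_covector_field atlas B \<and> smooth_covector_field atlas D \<and>
     (\<forall>c\<in>atlas. \<forall>p \<in> dom_chart c. \<forall>j k l.
        nabla_tensor02 g (Z_tensor g \<phi>) c p k j l =
          A c p k * Z_tensor g \<phi> c p j l + B c p j * Z_tensor g \<phi> c p k l
          + D c p l * Z_tensor g \<phi> c p k j)"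

definition covector_diff ::
  "('a, 'n::finite) covector \<Rightarrow> ('a, 'n) covector \<Rightarrow> ('a, 'n) covector" where
  "covector_diff B D c p k = B c p k - D c p k"

definition nowhere_zero ::
  "('a, 'n::finite) chart set \<Rightarrow> ('a, 'n) covector \<Rightarrow> bool" where
  "nowhere_zero atlas X \<longleftrightarrow> (\<forall>c\<in>atlas. \<forall>p \<in> dom_chart c. \<exists>k. X c p k \<noteq> 0)"

definition covector_norm ::
  "('a, 'n::finite) tensor02 \<Rightarrow> ('a, 'n) covector \<Rightarrow> ('a, 'n) chart \<Rightarrow> 'a \<Rightarrow> real" where
  "covector_norm g X c p =
     sqrt (\<Sum>i\<in>UNIV. \<Sum>j\<in>UNIV. inv_metric g c p i j * X c p i * X c p j)"

definition normalized_covector ::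
  "('a, 'n::finite) tensor02 \<Rightarrow> ('a, 'n) covector \<Rightarrow> ('a, 'n) covector" where
  "normalized_covector g X c p i = X c p i / covector_norm g X c p"

definition closed_covector ::
  "('a, 'n::finite) chart set \<Rightarrow> ('a, 'n) tensor02 \<Rightarrow> ('a, 'n) covector \<Rightarrow> bool" where
  "closed_covector atlas g X \<longleftrightarrow>
     (\<forall>c\<in>atlas. \<forall>p \<in> dom_chart c. \<forall>i j. nabla_covector g X c p i j = nabla_covector g X c p j i)"

definition proper_concircular ::
  "('a, 'n::finite) chart set \<Rightarrow> ('a, 'n) tensor02 \<Rightarrow> ('a, 'n) covector \<Rightarrow> bool" where
  "proper_concircular atlas g X \<longleftrightarrow> smooth_covector_field atlas X \<and>
     (\<exists>\<mu> \<rho>. smooth_covector_field atlas \<mu> \<and> smooth_scalar_field atlas \<rho> \<and>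
        (\<forall>c\<in>atlas. \<forall>p \<in> dom_chart c. \<forall>j l.
           nabla_covector g X c p j l = \<mu> c p j * X c p l + \<rho> p * g c p j l) \<and>
        closed_covector atlas g \<mu>)"

end

theory Submission
  imports Defs
begin

text \<open>
  Antisymmetrizing the weak Z symmetry equation in \<open>j, l\<close> gives \<open>\<eta>\<^sub>j Z\<^sub>k\<^sub>l = \<eta>\<^sub>l Z\<^sub>k\<^sub>j\<close>, hence
  \<open>Z\<^sub>k\<^sub>l = \<sigma> T\<^sub>k T\<^sub>l\<close> with \<open>T = \<eta> / \<parallel>\<eta>\<parallel>\<close> and \<open>\<sigma>\<close> the trace of \<open>Z\<close>. The divergence of the conformal tensor is
  expressed through \<open>\<nabla>\<^sub>k R\<^sub>j\<^sub>l - \<nabla>\<^sub>j R\<^sub>k\<^sub>l\<close> by the contracted second Bianchi identity, so harmonicity yields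
  \<open>\<nabla>\<^sub>k Z\<^sub>j\<^sub>l - \<nabla>\<^sub>j Z\<^sub>k\<^sub>l = w\<^sub>k g\<^sub>j\<^sub>l - w\<^sub>j g\<^sub>k\<^sub>l\<close> where \<open>w\<close> is a multiple of \<open>(n - 2) \<nabla>\<phi> + \<nabla>\<sigma>\<close>. By weak Z symmetry
  the left-hand side has the form \<open>\<sigma> (\<alpha>\<^sub>k T\<^sub>j - \<alpha>\<^sub>j T\<^sub>k) T\<^sub>l\<close>, which forces \<open>w = 0\<close>; so \<open>\<nabla>\<sigma>\<close> is, like
  \<open>\<nabla>\<phi>\<close>, parallel to \<open>T\<close>, and then the equation for \<open>\<nabla>Z\<close> gives \<open>\<nabla>T = 0\<close> wherever \<open>\<sigma> \<noteq> 0\<close>. In other words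
  \<open>T\<close> is proper concircular with \<open>f = 0\<close>.

  Finally \<open>\<sigma>\<close> satisfies a linear equation \<open>\<nabla>\<sigma> = \<sigma> a\<close>, so its zero set is open and closed, and it vanishes
  nowhere because \<open>Z\<close> is not identically zero on any component.
\<close>

section \<open>Functions of class \<open>C\<^sup>k\<close>\<close>

lemma partial_deriv_eq:
  assumes "(f has_derivative f') (at u)"
  shows "partial_deriv i f u = f' (axis i 1)"
  using frechet_derivative_at[OF assms] by (simp add: partial_deriv_def)

lemma has_derivative_partial_deriv:
  fixes f :: "real ^ 'n::finite \<Rightarrow> real"
  assumes "f differentiable (at u)"
  shows "(f has_derivative (\<lambda>v. \<Sum>i\<in>UNIV. v $ i * partial_deriv i f u)) (at u)"
proof -
  let ?D = "frechet_derivative f (at u)"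
  have D: "(f has_derivative ?D) (at u)"
    using assms frechet_derivative_works by blast
  then interpret linear ?D by (rule has_derivative_linear)
  have "?D = (\<lambda>v. \<Sum>i\<in>UNIV. v $ i * partial_deriv i f u)"
  proof
    fix v
    have "?D v = ?D (\<Sum>i\<in>UNIV. v $ i *\<^sub>R axis i 1)"
      using basis_expansion[of v] by (simp add: scalar_mult_eq_scaleR)
    then show "?D v = (\<Sum>i\<in>UNIV. v $ i * partial_deriv i f u)"
      by (simp add: sum scaleR partial_deriv_def)
  qed
  with D show ?thesis by simp
qed

lemma partial_deriv_cong:
  assumes "open U" "u \<in> U" "\<And>x. x \<in> U \<Longrightarrow> f x = g x"
  shows "partial_deriv i f u = partial_deriv i g u"
proof -
  have "(f has_derivative f') (at u) \<longleftrightarrow> (g has_derivative f') (at u)" for f'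
    using has_derivative_transform_within_open[OF _ assms(1,2), of f f' UNIV g]
      has_derivative_transform_within_open[OF _ assms(1,2), of g f' UNIV f] assms(3) by metis
  then show ?thesis by (simp add: partial_deriv_def frechet_derivative_def)
qed

lemma differentiable_cong_open:
  assumes "open U" "u \<in> U" "\<And>x. x \<in> U \<Longrightarrow> f x = g x" "f differentiable (at u)"
  shows "g differentiable (at u)"
  using assms has_derivative_transform_within_open[OF _ assms(1,2), of f _ UNIV g]
  unfolding differentiable_def by metis

text \<open>Differentiation at a point of the open set \<open>U\<close> sees only values on
  \<open>U\<close>. This allows the formulas for derivatives of products, inverses and roots, which
  hold only on \<open>U\<close>, to replace \<open>partial_deriv\<close> inside
  \<open>Ck_on\<close>.\<close>

lemma Ck_on_cong:
  assumes "open U" "\<And>x. x \<in> U \<Longrightarrow> f x = g x"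
  shows "Ck_on k U f \<longleftrightarrow> Ck_on k U g"
  using assms(2)
proof (induction k arbitrary: f g)
  case 0
  then show ?case using continuous_on_cong[of U U f g] by simp
next
  case (Suc k)
  have "Ck_on k U (partial_deriv i f) \<longleftrightarrow> Ck_on k U (partial_deriv i g)" for i
    by (rule Suc.IH) (rule partial_deriv_cong[OF assms(1)], use Suc.prems in auto)
  moreover have "f differentiable (at u) \<longleftrightarrow> g differentiable (at u)" if "u \<in> U" for u
    using differentiable_cong_open[OF assms(1) that, of f g]
      differentiable_cong_open[OF assms(1) that, of g f] Suc.prems by auto
  ultimately show ?case by auto
qed

text \<open>Continuity is demanded only of the top-order derivatives; that of the lower ones is
  recovered from differentiability.\<close>

lemma Ck_on_Suc_imp: "open U \<Longrightarrow> Ck_on (Suc k) U f \<Longrightarrow> Ck_on k U f"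
proof (induction k arbitrary: f)
  case 0
  then have "f differentiable_on U"
    by (auto simp: differentiable_on_def intro: differentiable_at_withinI)
  then show ?case using differentiable_imp_continuous_on by auto
qed auto

lemma Ck_on_subset: "Ck_on k U f \<Longrightarrow> V \<subseteq> U \<Longrightarrow> Ck_on k V f"
proof (induction k arbitrary: f)
  case 0
  then show ?case using continuous_on_subset by auto
qed auto

lemma Ck_on_const: "Ck_on k U (\<lambda>x. c)"
proof (induction k arbitrary: c)
  case (Suc k)
  have "partial_deriv i (\<lambda>x. c) = (\<lambda>x. 0)" for i :: 'a
    by (rule ext) (simp add: partial_deriv_def)
  with Suc show ?case by simp
qed simp

lemma partial_deriv_add:
  assumes "f differentiable (at u)" "g differentiable (at u)"
  shows "partial_deriv i (\<lambda>x. f x + g x) u = partial_deriv i f u + partial_deriv i g u"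
  using partial_deriv_eq[OF has_derivative_add[OF has_derivative_partial_deriv[OF assms(1)]
        has_derivative_partial_deriv[OF assms(2)]], of i]
  by (simp add: axis_def if_distrib [of "\<lambda>x. x * _"] cong: if_cong)

lemma partial_deriv_mult:
  assumes "f differentiable (at u)" "g differentiable (at u)"
  shows "partial_deriv i (\<lambda>x. f x * g x) u = f u * partial_deriv i g u + partial_deriv i f u * g u"
  using partial_deriv_eq[OF has_derivative_mult[OF has_derivative_partial_deriv[OF assms(1)]
        has_derivative_partial_deriv[OF assms(2)]], of i]
  by (simp add: axis_def if_distrib [of "\<lambda>x. x * _"] cong: if_cong)

lemma Ck_on_add:
  assumes "open U"
  shows "Ck_on k U f \<Longrightarrow> Ck_on k U g \<Longrightarrow> Ck_on k U (\<lambda>x. f x + g x)"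
proof (induction k arbitrary: f g)
  case 0
  then show ?case by (auto intro: continuous_on_add)
next
  case (Suc k)
  have "Ck_on k U (partial_deriv i (\<lambda>x. f x + g x)) \<longleftrightarrow>
      Ck_on k U (\<lambda>u. partial_deriv i f u + partial_deriv i g u)" for i
    by (rule Ck_on_cong[OF assms]) (use Suc.prems in \<open>auto intro: partial_deriv_add\<close>)
  with Suc show ?case by auto
qed

lemma Ck_on_mult:
  assumes "open U"
  shows "Ck_on k U f \<Longrightarrow> Ck_on k U g \<Longrightarrow> Ck_on k U (\<lambda>x. f x * g x)"
proof (induction k arbitrary: f g)
  case 0
  then show ?case by (auto intro: continuous_on_mult)
next
  case (Suc k)
  have "Ck_on k U (partial_deriv i (\<lambda>x. f x * g x)) \<longleftrightarrow>
      Ck_on k U (\<lambda>u. f u * partial_deriv i g u + partial_deriv i f u * g u)" for i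
    by (rule Ck_on_cong[OF assms]) (use Suc.prems in \<open>auto intro: partial_deriv_mult\<close>)
  with Suc show ?case
    using Ck_on_Suc_imp[OF assms] by (auto intro!: Ck_on_add[OF assms] Suc.IH)
qed

text \<open>Bootstrapping: the derivative of \<open>1/f\<close> is a product of factors
  \<open>1/f\<close>, which are C^k by induction, and a partial derivative of
  \<open>f\<close>.\<close>

lemma Ck_on_inverse:
  assumes "open U" "\<And>x. x \<in> U \<Longrightarrow> f x \<noteq> 0"
  shows "Ck_on k U f \<Longrightarrow> Ck_on k U (\<lambda>x. inverse (f x))"
proof (induction k)
  case 0
  then show ?case using assms by (auto intro: continuous_on_inverse)
next
  case (Suc k)
  have f: "f differentiable (at u)" if "u \<in> U" for u using Suc.prems that by auto
  have "partial_deriv i (\<lambda>x. inverse (f x)) u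
      = (- 1) * (inverse (f u) * inverse (f u)) * partial_deriv i f u" if "u \<in> U" for u i
    using partial_deriv_eq[OF Deriv.has_derivative_inverse[OF assms(2)[OF that]
        has_derivative_partial_deriv[OF f[OF that]]], of i]
    by (simp add: axis_def if_distrib [of "\<lambda>x. x * _"] cong: if_cong)
  then have "Ck_on k U (partial_deriv i (\<lambda>x. inverse (f x))) \<longleftrightarrow>
      Ck_on k U (\<lambda>u. (- 1) * (inverse (f u) * inverse (f u)) * partial_deriv i f u)" for i
    by (intro Ck_on_cong[OF assms(1)])
  moreover have "Ck_on k U (\<lambda>x. inverse (f x))"
    using Suc Ck_on_Suc_imp[OF assms(1)] by blast
  then have "Ck_on k U (\<lambda>u. (- 1) * (inverse (f u) * inverse (f u)) * partial_deriv i f u)" for i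
    using Suc.prems by (intro Ck_on_mult[OF assms(1)] Ck_on_const) auto
  moreover have "(\<lambda>x. inverse (f x)) differentiable (at u)" if "u \<in> U" for u
    using differentiable_inverse[OF f[OF that] assms(2)[OF that]] .
  ultimately show ?case by simp
qed

lemma Ck_on_sqrt:
  assumes "open U" "\<And>x. x \<in> U \<Longrightarrow> f x > 0"
  shows "Ck_on k U f \<Longrightarrow> Ck_on k U (\<lambda>x. sqrt (f x))"
proof (induction k)
  case 0
  then show ?case by (auto intro: continuous_on_real_sqrt)
next
  case (Suc k)
  have f: "f differentiable (at u)" if "u \<in> U" for u using Suc.prems that by auto
  have D: "((\<lambda>x. sqrt (f x)) has_derivative
      (\<lambda>v. (\<Sum>i\<in>UNIV. v $ i * partial_deriv i f u) * (inverse (sqrt (f u)) / 2))) (at u)"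
    if "u \<in> U" for u
    using has_derivative_real_sqrt[OF assms(2)[OF that] has_derivative_partial_deriv[OF f[OF that]]]
    by simp
  have "partial_deriv i (\<lambda>x. sqrt (f x)) u = 1/2 * inverse (sqrt (f u)) * partial_deriv i f u"
    if "u \<in> U" for u i
    using partial_deriv_eq[OF D[OF that], of i]
    by (simp add: axis_def if_distrib [of "\<lambda>x. x * _"] cong: if_cong)
  then have "Ck_on k U (partial_deriv i (\<lambda>x. sqrt (f x))) \<longleftrightarrow>
      Ck_on k U (\<lambda>u. 1/2 * inverse (sqrt (f u)) * partial_deriv i f u)" for i
    by (intro Ck_on_cong[OF assms(1)])
  moreover have "sqrt (f x) \<noteq> 0" if "x \<in> U" for x using assms(2)[OF that] by simp
  then have "Ck_on k U (\<lambda>x. inverse (sqrt (f x)))"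
    using Suc Ck_on_Suc_imp[OF assms(1)] by (intro Ck_on_inverse[OF assms(1)]) auto
  then have "Ck_on k U (\<lambda>u. 1/2 * inverse (sqrt (f u)) * partial_deriv i f u)" for i
    using Suc.prems by (intro Ck_on_mult[OF assms(1)] Ck_on_const) auto
  moreover have "(\<lambda>x. sqrt (f x)) differentiable (at u)" if "u \<in> U" for u
    using D[OF that] unfolding differentiable_def by blast
  ultimately show ?case by simp
qed

section \<open>Symmetry of second partial derivatives\<close>

lemma partial_deriv_along_axis:
  fixes f :: "real ^ 'n::finite \<Rightarrow> real"
  assumes "f differentiable (at (u + t *\<^sub>R axis i 1))"
  shows "((\<lambda>t. f (u + t *\<^sub>R axis i 1)) has_real_derivative
    partial_deriv i f (u + t *\<^sub>R axis i 1)) (at t)"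
proof -
  let ?x = "u + t *\<^sub>R axis i 1"
  have "((\<lambda>t. u + t *\<^sub>R axis i (1::real)) has_derivative (\<lambda>s. s *\<^sub>R axis i 1)) (at t)"
    by (auto intro!: derivative_eq_intros)
  from has_derivative_compose[OF this has_derivative_partial_deriv[OF assms]]
  show ?thesis
    by (simp add: has_field_derivative_def axis_def if_distrib [of "\<lambda>x. x * _"]
        if_distrib [of "\<lambda>x. _ * x"] mult_commute_abs cong: if_cong)
qed

text \<open>Two applications of the mean value theorem. The left-hand side is symmetric in \<open>i\<close> and \<open>j\<close>, so
  letting \<open>h\<close> tend to 0 proves that partial derivatives commute.\<close>
lemma second_difference:
  fixes f :: "real ^ 'n::finite \<Rightarrow> real"
  assumes f: "\<And>x. x \<in> U \<Longrightarrow> f differentiable (at x)"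
    and fi: "\<And>x. x \<in> U \<Longrightarrow> partial_deriv i f differentiable (at x)"
    and U: "\<And>s t. \<bar>s\<bar> \<le> h \<Longrightarrow> \<bar>t\<bar> \<le> h \<Longrightarrow> u + s *\<^sub>R axis i 1 + t *\<^sub>R axis j 1 \<in> U"
    and h: "h > 0"
  shows "\<exists>s t. 0 < s \<and> s < h \<and> 0 < t \<and> t < h \<and>
    f (u + h *\<^sub>R axis i 1 + h *\<^sub>R axis j 1) - f (u + h *\<^sub>R axis i 1) - f (u + h *\<^sub>R axis j 1) + f u
      = h * h * partial_deriv j (partial_deriv i f) (u + s *\<^sub>R axis i 1 + t *\<^sub>R axis j 1)"
proof -
  let ?i = "axis i (1::real)" and ?j = "axis j (1::real)"
  let ?F = "\<lambda>s. f (u + s *\<^sub>R ?i + h *\<^sub>R ?j) - f (u + s *\<^sub>R ?i)"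
  let ?F' = "\<lambda>s. partial_deriv i f (u + s *\<^sub>R ?i + h *\<^sub>R ?j) - partial_deriv i f (u + s *\<^sub>R ?i)"
  have "(?F has_real_derivative ?F' s) (at s)" if "0 \<le> s" "s \<le> h" for s
  proof -
    have "((\<lambda>s. f (u + s *\<^sub>R ?i)) has_real_derivative partial_deriv i f (u + s *\<^sub>R ?i)) (at s)"
      by (rule partial_deriv_along_axis) (rule f, use U[of s 0] that h in auto)
    moreover have "((\<lambda>s. f ((u + h *\<^sub>R ?j) + s *\<^sub>R ?i)) has_real_derivative
        partial_deriv i f ((u + h *\<^sub>R ?j) + s *\<^sub>R ?i)) (at s)"
      by (rule partial_deriv_along_axis)
        (rule f, use U[of s h] that h in \<open>auto simp: algebra_simps\<close>)
    then have "((\<lambda>s. f (u + s *\<^sub>R ?i + h *\<^sub>R ?j)) has_real_derivative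
        partial_deriv i f (u + s *\<^sub>R ?i + h *\<^sub>R ?j)) (at s)"
      by (simp add: algebra_simps)
    ultimately show ?thesis by (intro DERIV_diff)
  qed
  from MVT2[OF h this] obtain s where s: "0 < s" "s < h" "?F h - ?F 0 = (h - 0) * ?F' s"
    by auto
  have "((\<lambda>t. partial_deriv i f (u + s *\<^sub>R ?i + t *\<^sub>R ?j)) has_real_derivative
      partial_deriv j (partial_deriv i f) (u + s *\<^sub>R ?i + t *\<^sub>R ?j)) (at t)"
    if "0 \<le> t" "t \<le> h" for t
    by (rule partial_deriv_along_axis) (rule fi, use U[of s t] that h s in auto)
  from MVT2[OF h this] obtain t where t: "0 < t" "t < h"
    "?F' s = h * partial_deriv j (partial_deriv i f) (u + s *\<^sub>R ?i + t *\<^sub>R ?j)"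
    by auto
  show ?thesis
    by (rule exI[of _ s], rule exI[of _ t]) (use s t in \<open>auto simp: algebra_simps\<close>)
qed

text \<open>The second difference quotient converges to the mixed derivative: the intermediate point
  of \<open>second_difference\<close> tends to \<open>u\<close>, where that derivative is
  continuous.\<close>

lemma mixed_partial_deriv_le:
  fixes f :: "real ^ 'n::finite \<Rightarrow> real"
  assumes "open U" "u \<in> U" and f: "Ck_on 2 U f" and e: "e > 0"
  shows "\<exists>d>0. \<forall>h. 0 < h \<and> h < d \<longrightarrow>
    \<bar>(f (u + h *\<^sub>R axis i 1 + h *\<^sub>R axis j 1) - f (u + h *\<^sub>R axis i 1) - f (u + h *\<^sub>R axis j 1) + f u)
      / (h * h) - partial_deriv j (partial_deriv i f) u\<bar> < e"
proof -
  let ?i = "axis i (1::real)" and ?j = "axis j (1::real)"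
  let ?P = "partial_deriv j (partial_deriv i f)"
  have f1: "\<And>x. x \<in> U \<Longrightarrow> f differentiable (at x)"
    and f2: "\<And>x. x \<in> U \<Longrightarrow> partial_deriv i f differentiable (at x)"
    and P: "continuous_on U ?P"
    using f by (auto simp: numeral_2_eq_2)
  obtain r where r: "r > 0" "ball u r \<subseteq> U" using assms openE by blast
  obtain r' where r': "r' > 0" "\<And>x. x \<in> U \<Longrightarrow> dist x u < r' \<Longrightarrow> dist (?P x) (?P u) < e"
    using P \<open>u \<in> U\<close> e unfolding continuous_on_iff by blast
  \<comment> \<open>Half, because the two displacements \<open>s\<close> and \<open>t\<close> add up
    in the triangle inequality below.\<close>
  let ?d = "min r r' / 2"
  have near: "u + s *\<^sub>R ?i + t *\<^sub>R ?j \<in> U" "dist (u + s *\<^sub>R ?i + t *\<^sub>R ?j) u < r'"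
    if "\<bar>s\<bar> < ?d" "\<bar>t\<bar> < ?d" for s t
  proof -
    have "norm (s *\<^sub>R ?i + t *\<^sub>R ?j) \<le> \<bar>s\<bar> + \<bar>t\<bar>"
      by (rule norm_triangle_le) simp
    then have *: "dist (u + s *\<^sub>R ?i + t *\<^sub>R ?j) u < min r r'"
      using that by (auto simp: dist_norm algebra_simps)
    then show "u + s *\<^sub>R ?i + t *\<^sub>R ?j \<in> U" using r by (auto simp: dist_commute)
    show "dist (u + s *\<^sub>R ?i + t *\<^sub>R ?j) u < r'" using * by simp
  qed
  have "\<bar>(f (u + h *\<^sub>R ?i + h *\<^sub>R ?j) - f (u + h *\<^sub>R ?i) - f (u + h *\<^sub>R ?j) + f u)
      / (h * h) - ?P u\<bar> < e" if h: "0 < h" "h < ?d" for h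
  proof -
    obtain s t where st: "0 < s" "s < h" "0 < t" "t < h"
      "f (u + h *\<^sub>R ?i + h *\<^sub>R ?j) - f (u + h *\<^sub>R ?i) - f (u + h *\<^sub>R ?j) + f u
        = h * h * ?P (u + s *\<^sub>R ?i + t *\<^sub>R ?j)"
      using second_difference[OF f1 f2, where h=h and u=u and j=j and U=U] near h by fastforce
    have "\<bar>?P (u + s *\<^sub>R ?i + t *\<^sub>R ?j) - ?P u\<bar> < e"
      using r'(2)[OF near, of s t] st h by (auto simp: dist_real_def)
    then show ?thesis using st h by simp
  qed
  then show ?thesis by (intro exI[of _ ?d]) (use r r' in auto)
qed

lemma partial_deriv_commute:
  fixes f :: "real ^ 'n::finite \<Rightarrow> real"
  assumes "open U" "u \<in> U" "Ck_on 2 U f"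
  shows "partial_deriv i (partial_deriv j f) u = partial_deriv j (partial_deriv i f) u"
proof (rule ccontr)
  let ?a = "partial_deriv i (partial_deriv j f) u" and ?b = "partial_deriv j (partial_deriv i f) u"
  let ?Q = "\<lambda>i j h. (f (u + h *\<^sub>R axis i 1 + h *\<^sub>R axis j 1) - f (u + h *\<^sub>R axis i 1)
    - f (u + h *\<^sub>R axis j 1) + f u) / (h * h)"
  assume "?a \<noteq> ?b"
  then have e: "\<bar>?a - ?b\<bar> / 2 > 0" by simp
  obtain d where d: "d > 0" "\<And>h. 0 < h \<Longrightarrow> h < d \<Longrightarrow> \<bar>?Q j i h - ?a\<bar> < \<bar>?a - ?b\<bar> / 2"
    using mixed_partial_deriv_le[OF assms e, of j i] by auto
  obtain d' where d': "d' > 0" "\<And>h. 0 < h \<Longrightarrow> h < d' \<Longrightarrow> \<bar>?Q i j h - ?b\<bar> < \<bar>?a - ?b\<bar> / 2"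
    using mixed_partial_deriv_le[OF assms e, of i j] by auto
  let ?h = "min d d' / 2"
  have "?Q j i ?h = ?Q i j ?h" by (simp add: algebra_simps)
  moreover have "0 < ?h" "?h < d" "?h < d'" using d(1) d'(1) by auto
  ultimately have "\<bar>?Q i j ?h - ?a\<bar> < \<bar>?a - ?b\<bar> / 2" "\<bar>?Q i j ?h - ?b\<bar> < \<bar>?a - ?b\<bar> / 2"
    using d(2)[of ?h] d'(2)[of ?h] by metis+
  moreover have False if "\<bar>q - a\<bar> < \<bar>a - b\<bar> / 2" "\<bar>q - b\<bar> < \<bar>a - b\<bar> / 2" for q a b :: real
    using that by (simp add: abs_if split: if_splits)
  ultimately show False by blast
qed

text \<open>Gronwall's argument on segments: restricted to the segment from \<open>u0\<close> to
  \<open>x\<close>, the system becomes the scalar equation \<open>h' = h * b\<close> with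
  \<open>h 0 = 0\<close> and \<open>b\<close> bounded by compactness.\<close>

lemma linear_pde_zero_locally:
  fixes f :: "real ^ 'n::finite \<Rightarrow> real"
  assumes "open U" "u0 \<in> U" and f: "\<And>u. u \<in> U \<Longrightarrow> f differentiable (at u)"
    and a: "\<And>i. continuous_on U (a i)"
    and pde: "\<And>u i. u \<in> U \<Longrightarrow> partial_deriv i f u = f u * a i u"
    and zero: "f u0 = 0"
  shows "\<exists>r>0. ball u0 r \<subseteq> U \<and> (\<forall>u \<in> ball u0 r. f u = 0)"
proof -
  obtain r where r: "r > 0" "ball u0 r \<subseteq> U" using assms(1,2) openE by blast
  have "f x = 0" if x: "x \<in> ball u0 r" for x
  proof -
    define v where "v = x - u0"
    define h where "h = (\<lambda>t. f (u0 + t *\<^sub>R v))"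
    define b where "b = (\<lambda>t. \<Sum>i\<in>UNIV. v $ i * a i (u0 + t *\<^sub>R v))"
    have seg: "u0 + t *\<^sub>R v \<in> U" if "t \<in> {0..1}" for t
    proof -
      have "\<bar>t\<bar> * norm v \<le> norm v" using that by (intro mult_left_le_one_le) auto
      then have "dist u0 (u0 + t *\<^sub>R v) < r" using x by (simp add: v_def dist_norm norm_minus_commute)
      then show ?thesis using r by auto
    qed
    have "continuous_on {0..1} b"
      unfolding b_def
      by (intro continuous_intros continuous_on_compose2[OF a]) (use seg in auto)
    then have "bounded (b ` {0..1})"
      by (intro compact_imp_bounded compact_continuous_image) auto
    then obtain C where C: "\<And>t. t \<in> {0..1} \<Longrightarrow> \<bar>b t\<bar> \<le> C"
      by (simp add: bounded_iff) (metis atLeastAtMost_iff)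
    have h': "(h has_real_derivative h t * b t) (at t)" if "t \<in> {0..1}" for t
    proof -
      have "((\<lambda>t. u0 + t *\<^sub>R v) has_derivative (\<lambda>s. s *\<^sub>R v)) (at t)"
        by (auto intro!: derivative_eq_intros)
      from has_derivative_compose[OF this has_derivative_partial_deriv[OF f[OF seg[OF that]]]]
      have "(h has_derivative (\<lambda>s. s * (h t * b t))) (at t)"
        by (simp add: h_def b_def pde[OF seg[OF that]] sum_distrib_left algebra_simps)
      then show ?thesis by (simp add: has_field_derivative_def mult_commute_abs)
    qed
    \<comment> \<open>The weight makes the square nonincreasing: the derivative has the sign of
      \<open>b t - C\<close>, which is at most 0. As \<open>?E 0 = 0\<close>, this leaves
      \<open>h 1 = 0\<close>.\<close>
    let ?E = "\<lambda>t. (h t)\<^sup>2 * exp (- 2 * C * t)"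
    have "?E 1 \<le> ?E 0"
    proof (rule DERIV_nonpos_imp_nonincreasing[where f = ?E])
      fix t :: real assume t: "0 \<le> t" "t \<le> 1"
      have t01: "t \<in> {0..1}" using t by simp
      have "((\<lambda>t. exp (- 2 * C * t)) has_real_derivative exp (- 2 * C * t) * (- 2 * C)) (at t)"
        by (auto intro!: derivative_eq_intros)
      from DERIV_mult[OF DERIV_mult[OF h'[OF t01] h'[OF t01]] this]
      have "(?E has_real_derivative 2 * (h t)\<^sup>2 * (b t - C) * exp (- 2 * C * t)) (at t)"
        by (simp add: algebra_simps power2_eq_square)
      moreover have "b t - C \<le> 0" using C[of t] t by auto
      then have "2 * (h t)\<^sup>2 * (b t - C) * exp (- 2 * C * t) \<le> 0"
        by (simp add: mult_le_0_iff)
      ultimately show "\<exists>y. (?E has_real_derivative y) (at t) \<and> y \<le> 0" by blast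
    qed simp
    moreover have "?E 0 = 0" by (simp add: h_def zero)
    ultimately have "(h 1)\<^sup>2 \<le> 0" by (simp add: mult_le_0_iff)
    then show ?thesis by (simp add: h_def v_def)
  qed
  with r show ?thesis by blast
qed

section \<open>Calculus in a chart\<close>

lemma smooth_in_chart_subset: "smooth_in_chart c W f \<Longrightarrow> V \<subseteq> W \<Longrightarrow> smooth_in_chart c V f"
  unfolding smooth_in_chart_def smooth_on_def by (meson Ck_on_subset image_mono)

text \<open>A chart together with an open part \<open>W\<close> of its domain: the same calculus
  then serves for whole chart domains and for overlaps of two charts.\<close>

locale chart_region =
  fixes c :: "('a::topological_space, 'n::finite) chart" and W :: "'a set"
  assumes chart: "is_chart c" and W_open: "open W" and W_sub: "W \<subseteq> dom_chart c"
begin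

lemma chart_inv_coords: "p \<in> dom_chart c \<Longrightarrow> chart_inv c (coords c p) = p"
  using chart by (auto simp: is_chart_def homeomorphism_def)

lemma continuous_coords: "continuous_on (dom_chart c) (coords c)"
  using chart by (auto simp: is_chart_def homeomorphism_def)

lemma open_coords_image: "open (coords c ` W)"
proof -
  let ?V = "coords c ` dom_chart c"
  have V: "open ?V" "continuous_on ?V (chart_inv c)"
    using chart by (auto simp: is_chart_def homeomorphism_def)
  then have "open (chart_inv c -` W \<inter> ?V)"
    using W_open continuous_on_open_vimage by blast
  moreover have "chart_inv c -` W \<inter> ?V = coords c ` W"
    using W_sub chart_inv_coords by (force simp: subset_iff)
  ultimately show ?thesis by simp
qed

lemma region_subset: "open V \<Longrightarrow> V \<subseteq> W \<Longrightarrow> chart_region c V"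
  using chart W_sub by unfold_locales auto

abbreviation sm :: "('a \<Rightarrow> real) \<Rightarrow> bool" where
  "sm f \<equiv> smooth_in_chart c W f"

abbreviation D :: "'n \<Rightarrow> ('a \<Rightarrow> real) \<Rightarrow> 'a \<Rightarrow> real" where
  "D \<equiv> coord_deriv c"

lemma sm_Ck: "sm f \<Longrightarrow> Ck_on k (coords c ` W) (\<lambda>u. f (chart_inv c u))"
  by (auto simp: smooth_in_chart_def smooth_on_def o_def)

lemma smI: "(\<And>k. Ck_on k (coords c ` W) (\<lambda>u. f (chart_inv c u))) \<Longrightarrow> sm f"
  by (auto simp: smooth_in_chart_def smooth_on_def o_def)

lemma chart_inv_image: "u \<in> coords c ` W \<Longrightarrow> chart_inv c u \<in> W"
  using W_sub chart_inv_coords by auto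

lemma sm_cong: "(\<And>q. q \<in> W \<Longrightarrow> f q = g q) \<Longrightarrow> sm f \<longleftrightarrow> sm g"
  unfolding smooth_in_chart_def smooth_on_def
  by (intro all_cong1 Ck_on_cong[OF open_coords_image]) (use chart_inv_image in auto)

lemma sm_const [simp]: "sm (\<lambda>q. k)"
  by (intro smI Ck_on_const)

lemma sm_add: "sm f \<Longrightarrow> sm g \<Longrightarrow> sm (\<lambda>q. f q + g q)"
  by (rule smI, rule Ck_on_add[OF open_coords_image]) (rule sm_Ck, assumption)+

lemma sm_mult: "sm f \<Longrightarrow> sm g \<Longrightarrow> sm (\<lambda>q. f q * g q)"
  by (rule smI, rule Ck_on_mult[OF open_coords_image]) (rule sm_Ck, assumption)+

lemma sm_minus: "sm f \<Longrightarrow> sm (\<lambda>q. - f q)"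
  using sm_mult[OF sm_const[of "-1"]] by simp

lemma sm_diff: "sm f \<Longrightarrow> sm g \<Longrightarrow> sm (\<lambda>q. f q - g q)"
  using sm_add[OF _ sm_minus] by simp

lemma sm_sum: "(\<And>x. x \<in> S \<Longrightarrow> sm (f x)) \<Longrightarrow> sm (\<lambda>q. \<Sum>x\<in>S. f x q)"
  by (induction S rule: infinite_finite_induct) (auto intro: sm_add)

lemma sm_prod: "(\<And>x. x \<in> S \<Longrightarrow> sm (f x)) \<Longrightarrow> sm (\<lambda>q. \<Prod>x\<in>S. f x q)"
  by (induction S rule: infinite_finite_induct) (auto intro: sm_mult)

lemma sm_inverse: "sm f \<Longrightarrow> (\<And>q. q \<in> W \<Longrightarrow> f q \<noteq> 0) \<Longrightarrow> sm (\<lambda>q. inverse (f q))"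
  by (rule smI, rule Ck_on_inverse[OF open_coords_image]) (use chart_inv_image sm_Ck in auto)

lemma sm_divide: "sm f \<Longrightarrow> sm g \<Longrightarrow> (\<And>q. q \<in> W \<Longrightarrow> g q \<noteq> 0) \<Longrightarrow> sm (\<lambda>q. f q / g q)"
  unfolding divide_inverse by (intro sm_mult sm_inverse)

lemma sm_sqrt: "sm f \<Longrightarrow> (\<And>q. q \<in> W \<Longrightarrow> f q > 0) \<Longrightarrow> sm (\<lambda>q. sqrt (f q))"
  by (rule smI, rule Ck_on_sqrt[OF open_coords_image]) (use chart_inv_image sm_Ck in auto)

lemma sm_D: "sm f \<Longrightarrow> sm (D i f)"
proof (rule smI)
  fix k assume f: "sm f"
  have "Ck_on k (coords c ` W) (partial_deriv i (\<lambda>u. f (chart_inv c u)))"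
    using sm_Ck[OF f, of "Suc k"] by auto
  also have "?this \<longleftrightarrow> Ck_on k (coords c ` W) (\<lambda>u. D i f (chart_inv c u))"
    by (rule Ck_on_cong[OF open_coords_image])
      (use W_sub chart_inv_coords in \<open>auto simp: coord_deriv_def o_def\<close>)
  finally show "Ck_on k (coords c ` W) (\<lambda>u. D i f (chart_inv c u))" .
qed

lemma sm_continuous: "sm f \<Longrightarrow> continuous_on W f"
proof -
  assume "sm f"
  then have "continuous_on (coords c ` W) (\<lambda>u. f (chart_inv c u))"
    using sm_Ck[of f 0] by simp
  then have "continuous_on W (\<lambda>q. f (chart_inv c (coords c q)))"
    by (rule continuous_on_compose2[OF _ continuous_on_subset[OF continuous_coords W_sub]]) simp
  then show ?thesis
    by (rule continuous_on_eq) (use W_sub chart_inv_coords in \<open>simp add: subset_iff\<close>)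
qed

lemma sm_differentiable:
  "sm f \<Longrightarrow> p \<in> W \<Longrightarrow> (\<lambda>u. f (chart_inv c u)) differentiable (at (coords c p))"
  using sm_Ck[of f "Suc 0"] by auto

lemma D_cong: "(\<And>q. q \<in> W \<Longrightarrow> f q = g q) \<Longrightarrow> p \<in> W \<Longrightarrow> D i f p = D i g p"
  unfolding coord_deriv_def
  by (rule partial_deriv_cong[OF open_coords_image]) (use chart_inv_image in auto)

lemma D_const [simp]: "D i (\<lambda>q. k) p = 0"
  by (simp add: coord_deriv_def partial_deriv_def o_def)

lemma D_add: "sm f \<Longrightarrow> sm g \<Longrightarrow> p \<in> W \<Longrightarrow> D i (\<lambda>q. f q + g q) p = D i f p + D i g p"
  by (simp add: coord_deriv_def o_def partial_deriv_add sm_differentiable)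

lemma D_mult:
  "sm f \<Longrightarrow> sm g \<Longrightarrow> p \<in> W \<Longrightarrow> D i (\<lambda>q. f q * g q) p = f p * D i g p + D i f p * g p"
  using W_sub
  by (auto simp: coord_deriv_def o_def partial_deriv_mult sm_differentiable chart_inv_coords subset_iff)

lemma D_cmult: "sm f \<Longrightarrow> p \<in> W \<Longrightarrow> D i (\<lambda>q. k * f q) p = k * D i f p"
  using D_mult[OF sm_const[of k]] by simp

lemma D_minus: "sm f \<Longrightarrow> p \<in> W \<Longrightarrow> D i (\<lambda>q. - f q) p = - D i f p"
  using D_mult[OF sm_const[of "-1"]] by simp

lemma D_diff: "sm f \<Longrightarrow> sm g \<Longrightarrow> p \<in> W \<Longrightarrow> D i (\<lambda>q. f q - g q) p = D i f p - D i g p"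
  using D_add[OF _ sm_minus] D_minus by simp

lemma D_sum:
  "(\<And>x. x \<in> S \<Longrightarrow> sm (f x)) \<Longrightarrow> p \<in> W \<Longrightarrow>
    D i (\<lambda>q. \<Sum>x\<in>S. f x q) p = (\<Sum>x\<in>S. D i (f x) p)"
  by (induction S rule: infinite_finite_induct) (auto simp: D_add sm_sum)

lemma D_commute: "sm f \<Longrightarrow> p \<in> W \<Longrightarrow> D i (D j f) p = D j (D i f) p"
proof -
  assume f: "sm f" and p: "p \<in> W"
  let ?f = "\<lambda>u. f (chart_inv c u)"
  have "D i (D j f) p = partial_deriv i (partial_deriv j ?f) (coords c p)" for i j
    unfolding coord_deriv_def[of c i]
    by (rule partial_deriv_cong[OF open_coords_image])
      (use p W_sub chart_inv_coords in \<open>auto simp: coord_deriv_def o_def\<close>)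
  with partial_deriv_commute[OF open_coords_image _ sm_Ck[OF f]] p show ?thesis by auto
qed

text \<open>The local uniqueness statement transported through the chart. It shows that the zero set
  of a solution of a linear first-order system is open.\<close>

lemma linear_pde_zero_nbhd:
  assumes f: "sm f" and a: "\<And>i. sm (a i)" and p: "p \<in> W" and zero: "f p = 0"
    and pde: "\<And>q i. q \<in> W \<Longrightarrow> D i f q = f q * a i q"
  shows "\<exists>V. open V \<and> p \<in> V \<and> V \<subseteq> W \<and> (\<forall>q\<in>V. f q = 0)"
proof -
  let ?U = "coords c ` W"
  obtain r where r: "r > 0" "ball (coords c p) r \<subseteq> ?U"
    "\<And>u. u \<in> ball (coords c p) r \<Longrightarrow> f (chart_inv c u) = 0"
  proof -
    have "\<exists>r>0. ball (coords c p) r \<subseteq> ?U \<and>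
        (\<forall>u\<in>ball (coords c p) r. f (chart_inv c u) = 0)"
    proof (rule linear_pde_zero_locally[OF open_coords_image])
      show "(\<lambda>u. f (chart_inv c u)) differentiable (at u)" if "u \<in> ?U" for u
        using that sm_differentiable[OF f] by auto
      show "continuous_on ?U (\<lambda>u. a i (chart_inv c u))" for i
        using sm_Ck[OF a, of 0] by simp
      show "partial_deriv i (\<lambda>u. f (chart_inv c u)) u = f (chart_inv c u) * a i (chart_inv c u)"
        if "u \<in> ?U" for u i
        using that pde chart_inv_coords W_sub by (auto simp: coord_deriv_def o_def)
    qed (use p zero chart_inv_coords W_sub in auto)
    then show ?thesis using that by blast
  qed
  let ?V = "coords c -` ball (coords c p) r \<inter> W"
  have "open ?V"
    using continuous_on_open_vimage[OF W_open, of "coords c"] continuous_on_subset[OF continuous_coords W_sub]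
    by blast
  moreover have "f q = 0" if "q \<in> ?V" for q
    using that r(3)[of "coords c q"] chart_inv_coords[of q] W_sub by auto
  ultimately show ?thesis using p r(1) by (intro exI[of _ ?V]) auto
qed

end

text \<open>On \<open>W\<close> the expression of \<open>f\<close> in chart \<open>c\<close> is its
  expression in \<open>d\<close> composed with the transition map \<open>?y\<close>.
  Differentiability is stated separately because \<open>Ck_transfer\<close> needs it.\<close>

lemma coord_deriv_chain:
  assumes c: "chart_region c W" and d: "chart_region d W" and p: "p \<in> W"
    and y: "\<And>a. smooth_in_chart c W (\<lambda>q. coords d q $ a)"
    and f: "smooth_in_chart d W f"
  shows "(\<lambda>u. f (chart_inv c u)) differentiable (at (coords c p))"
    and "coord_deriv c k f p =
      (\<Sum>a\<in>UNIV. coord_deriv c k (\<lambda>q. coords d q $ a) p * coord_deriv d a f p)"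
proof -
  interpret c: chart_region c W by fact
  interpret d: chart_region d W by fact
  let ?u = "coords c p" and ?y = "\<lambda>u. coords d (chart_inv c u)" and ?f = "\<lambda>v. f (chart_inv d v)"
  let ?y' = "\<lambda>v. \<chi> a. \<Sum>i\<in>UNIV. v $ i * partial_deriv i (\<lambda>u. ?y u $ a) ?u"
  have pc: "chart_inv c ?u = p" using p c.W_sub c.chart_inv_coords by auto
  have "(?y has_derivative ?y') (at ?u)"
    unfolding has_derivative_componentwise_within[of ?y]
    using has_derivative_partial_deriv[OF c.sm_differentiable[OF y p]]
    by (auto simp: Basis_vec_def inner_axis)
  moreover have "(?f has_derivative (\<lambda>v. \<Sum>i\<in>UNIV. v $ i * partial_deriv i ?f (?y ?u))) (at (?y ?u))"
    using has_derivative_partial_deriv[OF d.sm_differentiable[OF f p]] by (simp add: pc)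
  ultimately have D: "((\<lambda>u. ?f (?y u)) has_derivative
      (\<lambda>v. \<Sum>i\<in>UNIV. ?y' v $ i * partial_deriv i ?f (?y ?u))) (at ?u)"
    by (rule has_derivative_compose)
  from partial_deriv_eq[OF D, of k]
  have "partial_deriv k (\<lambda>u. ?f (?y u)) ?u =
      (\<Sum>a\<in>UNIV. coord_deriv c k (\<lambda>q. coords d q $ a) p * coord_deriv d a f p)"
    by (simp add: coord_deriv_def o_def pc axis_def if_distrib [of "\<lambda>x. x * _"] cong: if_cong)
  moreover have eq: "?f (?y u) = f (chart_inv c u)" if "u \<in> coords c ` W" for u
    using that c.chart_inv_image d.chart_inv_coords d.W_sub by (auto simp: subset_iff)
  have u: "?u \<in> coords c ` W" using p by simp
  have "partial_deriv k (\<lambda>u. ?f (?y u)) ?u = partial_deriv k (\<lambda>u. f (chart_inv c u)) ?u"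
    by (rule partial_deriv_cong[OF c.open_coords_image u eq])
  ultimately show "coord_deriv c k f p =
      (\<Sum>a\<in>UNIV. coord_deriv c k (\<lambda>q. coords d q $ a) p * coord_deriv d a f p)"
    by (simp add: coord_deriv_def o_def)
  show "(\<lambda>u. f (chart_inv c u)) differentiable (at ?u)"
    by (rule differentiable_cong_open[OF c.open_coords_image u eq differentiableI[OF D]])
qed

section \<open>Metric and Levi-Civita connection\<close>

text \<open>Contraction with a Kronecker delta in all four orientations, so that the simplifier
  performs it.\<close>

lemma sum_if_eq [simp]:
  fixes f :: "'n::finite \<Rightarrow> real"
  shows "(\<Sum>s\<in>UNIV. (if i = s then 1 else 0) * f s) = f i"
    "(\<Sum>s\<in>UNIV. f s * (if i = s then 1 else 0)) = f i"
    "(\<Sum>s\<in>UNIV. (if s = i then 1 else 0) * f s) = f i"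
    "(\<Sum>s\<in>UNIV. f s * (if s = i then 1 else 0)) = f i"
  by (simp_all add: if_distrib [of "\<lambda>x. x * _"] if_distrib [of "\<lambda>x. _ * x"] cong: if_cong)

lemma matrix_inv_inverse:
  fixes A :: "real ^ 'n::finite ^ 'n"
  assumes "invertible A"
  shows "A ** matrix_inv A = mat 1" "matrix_inv A ** A = mat 1"
  using someI_ex[OF assms[unfolded invertible_def]] by (auto simp: matrix_inv_def)

text \<open>Associativity of matrix products in index form. Used in either direction, it brings
  \<open>G\<close> next to \<open>H\<close> so that they cancel.\<close>

lemma sum_sum_assoc:
  fixes a :: "'n::finite \<Rightarrow> real" and c :: "'m::finite \<Rightarrow> real"
  shows "(\<Sum>s\<in>UNIV. (\<Sum>t\<in>UNIV. a t * b t s) * c s) = (\<Sum>t\<in>UNIV. a t * (\<Sum>s\<in>UNIV. b t s * c s))"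
  unfolding sum_distrib_left sum_distrib_right by (subst sum.swap) (simp add: mult.assoc)

lemma sum_swap_UNIV:
  "(\<Sum>s\<in>UNIV. \<Sum>t\<in>UNIV. f s t) = (\<Sum>s\<in>UNIV. \<Sum>t\<in>UNIV. (f t s :: real))"
  by (rule sum.swap)

lemma sum4_reverse:
  "(\<Sum>m\<in>UNIV. \<Sum>n\<in>UNIV. \<Sum>t\<in>UNIV. \<Sum>s\<in>UNIV. f m n t s)
    = (\<Sum>m\<in>UNIV. \<Sum>n\<in>UNIV. \<Sum>t\<in>UNIV. \<Sum>s\<in>UNIV. (f s t n m :: real))"
proof -
  have "(\<Sum>(m, n, t, s)\<in>UNIV. f m n t s) = (\<Sum>(m, n, t, s)\<in>UNIV. f s t n m)"
    by (rule sum.reindex_bij_witness[of _ "\<lambda>(m, n, t, s). (s, t, n, m)"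
          "\<lambda>(m, n, t, s). (s, t, n, m)"]) auto
  then show ?thesis
    by (simp add: sum.cartesian_product case_prod_unfold)
qed

locale riemannian_region = chart_region c W
  for c :: "('a::topological_space, 'n::finite) chart" and W :: "'a set" +
  fixes g :: "('a, 'n) tensor02"
  assumes g_sm: "smooth_in_chart c W (\<lambda>q. g c q i j)"
    and g_sym: "q \<in> W \<Longrightarrow> g c q i j = g c q j i"
    and g_pos: "q \<in> W \<Longrightarrow> v \<noteq> 0 \<Longrightarrow> (\<Sum>i\<in>UNIV. \<Sum>j\<in>UNIV. g c q i j * v $ i * v $ j) > 0"
begin

abbreviation G :: "'a \<Rightarrow> 'n \<Rightarrow> 'n \<Rightarrow> real" where "G \<equiv> g c"
abbreviation H :: "'a \<Rightarrow> 'n \<Rightarrow> 'n \<Rightarrow> real" where "H \<equiv> inv_metric g c"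
abbreviation \<Gamma> :: "'a \<Rightarrow> 'n \<Rightarrow> 'n \<Rightarrow> 'n \<Rightarrow> real" where "\<Gamma> \<equiv> christoffel g c"

lemma region_subset_riemannian:
  assumes "open V" "V \<subseteq> W"
  shows "riemannian_region c V g"
proof -
  interpret V: chart_region c V by (rule region_subset[OF assms])
  show ?thesis
    by unfold_locales (use g_sym g_pos assms smooth_in_chart_subset[OF g_sm] in blast)+
qed

lemma metric_invertible: "q \<in> W \<Longrightarrow> invertible (\<chi> a b. G q a b)"
proof -
  assume q: "q \<in> W"
  let ?M = "\<chi> a b. G q a b"
  have "x = 0" if "?M *v x = 0" for x
  proof (rule ccontr)
    assume "x \<noteq> 0"
    from g_pos[OF q this] have "x \<bullet> (?M *v x) > 0"
      by (simp add: inner_vec_def matrix_vector_mult_def sum_distrib_left algebra_simps)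
    with that show False by simp
  qed
  then show ?thesis using matrix_left_invertible_ker invertible_left_inverse by blast
qed

lemma metric_inv:
  assumes "q \<in> W"
  shows "(\<Sum>s\<in>UNIV. G q i s * H q s j) = (if i = j then 1 else 0)"
    and "(\<Sum>s\<in>UNIV. H q i s * G q s j) = (if i = j then 1 else 0)"
proof -
  have "matrix_inv (\<chi> a b. G q a b) ** (\<chi> a b. G q a b) = mat 1"
    "(\<chi> a b. G q a b) ** matrix_inv (\<chi> a b. G q a b) = mat 1"
    using metric_invertible[OF assms] matrix_inv_inverse by blast+
  from arg_cong[OF this(1), of "\<lambda>M. M $ i $ j"] arg_cong[OF this(2), of "\<lambda>M. M $ i $ j"]
  show "(\<Sum>s\<in>UNIV. G q i s * H q s j) = (if i = j then 1 else 0)"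
    and "(\<Sum>s\<in>UNIV. H q i s * G q s j) = (if i = j then 1 else 0)"
    by (simp_all add: inv_metric_def matrix_matrix_mult_def mat_def)
qed

lemma inv_metric_unique:
  assumes q: "q \<in> W" and K: "\<And>i j. (\<Sum>s\<in>UNIV. K i s * G q s j) = (if i = j then 1 else 0)"
  shows "K i j = H q i j"
proof -
  have "K i j = (\<Sum>t\<in>UNIV. K i t * (\<Sum>s\<in>UNIV. G q t s * H q s j))"
    by (simp add: metric_inv[OF q])
  also have "\<dots> = (\<Sum>s\<in>UNIV. (\<Sum>t\<in>UNIV. K i t * G q t s) * H q s j)"
    by (rule sum_sum_assoc[symmetric])
  finally show ?thesis by (simp add: K)
qed

lemma inv_metric_sym: "q \<in> W \<Longrightarrow> H q i j = H q j i"
proof (rule inv_metric_unique[symmetric])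
  assume q: "q \<in> W"
  show "(\<Sum>s\<in>UNIV. H q s i * G q s j) = (if i = j then 1 else 0)" for i j
    using metric_inv(1)[OF q, of j i] g_sym[OF q] by (simp add: mult.commute eq_commute)
qed

text \<open>Raising the index of \<open>X\<close> gives a nonzero vector \<open>v\<close> with
  \<open>G v = X\<close>, and the form at \<open>X\<close> equals \<open>G\<close> evaluated on
  \<open>v\<close>.\<close>

lemma inv_metric_pos:
  assumes q: "q \<in> W" and X: "X k \<noteq> 0"
  shows "(\<Sum>i\<in>UNIV. \<Sum>j\<in>UNIV. H q i j * X i * X j) > 0"
proof -
  define v :: "real ^ 'n" where "v = (\<chi> i. \<Sum>j\<in>UNIV. H q i j * X j)"
  have Gv: "(\<Sum>j\<in>UNIV. G q i j * v $ j) = X i" for i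
    using sum_sum_assoc[of "\<lambda>j. G q i j" "\<lambda>j s. H q j s" X] by (simp add: v_def metric_inv[OF q])
  have "v \<noteq> 0" using Gv[of k] X by auto
  from g_pos[OF q this] have "0 < (\<Sum>i\<in>UNIV. v $ i * (\<Sum>j\<in>UNIV. G q i j * v $ j))"
    by (simp add: sum_distrib_left algebra_simps)
  also have "\<dots> = (\<Sum>i\<in>UNIV. \<Sum>j\<in>UNIV. H q i j * X i * X j)"
    unfolding Gv by (simp add: v_def sum_distrib_right sum_distrib_left algebra_simps)
  finally show ?thesis .
qed

text \<open>Cramer's rule: the entries are quotients of determinants, hence rational in the
  components of the metric.\<close>

lemma inv_metric_sm: "sm (\<lambda>q. H q i j)"
proof -
  \<comment> \<open>The metric matrix with column \<open>i\<close> replaced by the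
    \<open>j\<close>-th unit vector, as Cramer's rule prescribes for the entry in row
    \<open>i\<close> and column \<open>j\<close> of the inverse.\<close>
  let ?N = "\<lambda>q. \<chi> a b. if b = i then axis j 1 $ a else G q a b"
  let ?M = "\<lambda>q. \<chi> a b. G q a b"
  have "H q i j = det (?N q) / det (?M q)" if "q \<in> W" for q
  proof -
    have "?M q *v (matrix_inv (?M q) *v axis j 1) = axis j 1"
      using matrix_inv_inverse[OF metric_invertible[OF that]] by (simp add: matrix_vector_mul_assoc)
    then have "matrix_inv (?M q) *v axis j 1
        = (\<chi> k. det (\<chi> a b. if b = k then axis j 1 $ a else ?M q $ a $ b) / det (?M q))"
      using cramer[of "?M q"] metric_invertible[OF that] invertible_det_nz by blast
    from arg_cong[OF this, of "\<lambda>x. x $ i"] show ?thesis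
      by (simp add: inv_metric_def matrix_vector_mult_basis column_def cong: if_cong)
  qed
  moreover have "sm (\<lambda>q. det (?N q) / det (?M q))"
  proof (rule sm_divide)
    have "sm (\<lambda>q. if b then axis j 1 $ a else G q k l)" for a b k l
      by (cases b) (auto intro: g_sm)
    then show "sm (\<lambda>q. det (?N q))" unfolding det_def
      by (simp, intro sm_sum sm_mult sm_const sm_prod)
    show "sm (\<lambda>q. det (?M q))" unfolding det_def
      by (simp, intro sm_sum sm_mult sm_const sm_prod g_sm)
    show "det (?M q) \<noteq> 0" if "q \<in> W" for q
      using metric_invertible[OF that] invertible_det_nz by blast
  qed
  ultimately show ?thesis by (subst sm_cong)
qed

lemma christoffel_sm: "sm (\<lambda>q. \<Gamma> q k i j)"
  unfolding christoffel_def
  by (intro sm_mult sm_const sm_sum sm_add sm_diff sm_D g_sm inv_metric_sm)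

lemma riemann_sm: "sm (\<lambda>q. riemann g c q j k l m)"
  unfolding riemann_def
  by (intro sm_mult sm_sum sm_add sm_diff sm_D christoffel_sm)

lemma ricci_sm: "sm (\<lambda>q. ricci g c q k l)"
  unfolding ricci_def by (intro sm_minus sm_sum riemann_sm)

lemma scalar_curv_sm: "sm (scalar_curv g c)"
  unfolding scalar_curv_def[abs_def] by (intro sm_sum sm_mult inv_metric_sm ricci_sm)

lemma ricci_mixed_sm: "sm (\<lambda>q. ricci_mixed g c q j m)"
  unfolding ricci_mixed_def by (intro sm_sum sm_mult inv_metric_sm ricci_sm)

lemmas field_sm = g_sm inv_metric_sm christoffel_sm riemann_sm ricci_sm scalar_curv_sm ricci_mixed_sm
lemmas sm_rules = sm_const sm_add sm_diff sm_minus sm_mult sm_sum sm_D field_sm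
lemmas D_rules = D_add D_diff D_minus D_mult D_sum

section \<open>Christoffel symbols and compatibility with the metric\<close>

lemma D_metric_sym: "p \<in> W \<Longrightarrow> D k (\<lambda>q. G q i j) p = D k (\<lambda>q. G q j i) p"
  using g_sym by (intro D_cong) auto

lemma christoffel_sym: "p \<in> W \<Longrightarrow> \<Gamma> p m i j = \<Gamma> p m j i"
  unfolding christoffel_def using D_metric_sym[of p _ i j] by (simp add: algebra_simps)

lemma christoffel_lower:
  assumes p: "p \<in> W"
  shows "(\<Sum>m\<in>UNIV. \<Gamma> p m i j * G p m k) =
    (D i (\<lambda>q. G q j k) p + D j (\<lambda>q. G q i k) p - D k (\<lambda>q. G q i j) p) / 2"
proof -
  let ?L = "\<lambda>k. D i (\<lambda>q. G q j k) p + D j (\<lambda>q. G q i k) p - D k (\<lambda>q. G q i j) p"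
  have "(\<Sum>m\<in>UNIV. \<Gamma> p m i j * G p m k) = (\<Sum>m\<in>UNIV. (\<Sum>s\<in>UNIV. ?L s * H p s m) * G p m k) / 2"
    unfolding christoffel_def sum_divide_distrib
    by (intro sum.cong refl) (simp add: inv_metric_sym[OF p, of m for m] mult.commute)
  also have "\<dots> = ?L k / 2" by (simp add: sum_sum_assoc metric_inv[OF p])
  finally show ?thesis .
qed

text \<open>The sum of the Christoffel symbols with lowered index, taken in the orders
  \<open>k, i, j\<close> and \<open>k, j, i\<close>: four of the six derivative terms cancel and the
  other two agree.\<close>

lemma D_metric:
  assumes p: "p \<in> W"
  shows "D k (\<lambda>q. G q i j) p = (\<Sum>s\<in>UNIV. \<Gamma> p s k i * G p s j) + (\<Sum>s\<in>UNIV. \<Gamma> p s k j * G p i s)"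
proof -
  have "(\<Sum>s\<in>UNIV. \<Gamma> p s k j * G p i s) = (\<Sum>s\<in>UNIV. \<Gamma> p s k j * G p s i)"
    using g_sym[OF p] by simp
  then show ?thesis
    using christoffel_lower[OF p, of k i j] christoffel_lower[OF p, of k j i]
      D_metric_sym[OF p, of k i j] by (simp add: field_simps)
qed

lemma nabla_metric: "p \<in> W \<Longrightarrow> nabla_tensor02 g g c p k i j = 0"
  by (simp add: nabla_tensor02_def D_metric)

text \<open>Differentiating \<open>H G = 1\<close> gives \<open>dH G = - H dG\<close>;
  multiplication by \<open>H\<close> from the right isolates \<open>dH\<close>.\<close>

lemma D_inv_metric_aux:
  assumes p: "p \<in> W"
  shows "D k (\<lambda>q. H q i j) p = - (\<Sum>t\<in>UNIV. (\<Sum>s\<in>UNIV. H p i s * D k (\<lambda>q. G q s t) p) * H p t j)"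
proof -
  have "(\<Sum>s\<in>UNIV. D k (\<lambda>q. H q i s) p * G p s t) = - (\<Sum>s\<in>UNIV. H p i s * D k (\<lambda>q. G q s t) p)" for t
  proof -
    have "D k (\<lambda>q. \<Sum>s\<in>UNIV. H q i s * G q s t) p = D k (\<lambda>q. if i = t then 1 else 0) p"
      by (rule D_cong[OF _ p]) (rule metric_inv)
    then have "(\<Sum>s\<in>UNIV. H p i s * D k (\<lambda>q. G q s t) p + D k (\<lambda>q. H q i s) p * G p s t) = 0"
      using p by (simp add: D_rules sm_rules)
    then show ?thesis by (simp add: sum.distrib)
  qed
  then have "- (\<Sum>t\<in>UNIV. (\<Sum>s\<in>UNIV. H p i s * D k (\<lambda>q. G q s t) p) * H p t j)
      = (\<Sum>t\<in>UNIV. (\<Sum>s\<in>UNIV. D k (\<lambda>q. H q i s) p * G p s t) * H p t j)"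
    by (simp add: sum_negf)
  also have "\<dots> = D k (\<lambda>q. H q i j) p"
    unfolding sum_sum_assoc by (simp add: metric_inv[OF p])
  finally show ?thesis by simp
qed

lemma D_inv_metric:
  assumes p: "p \<in> W"
  shows "D k (\<lambda>q. H q i j) p = - (\<Sum>s\<in>UNIV. \<Gamma> p i k s * H p s j) - (\<Sum>s\<in>UNIV. \<Gamma> p j k s * H p i s)"
proof -
  have 1: "(\<Sum>s\<in>UNIV. H p i s * (\<Sum>a\<in>UNIV. \<Gamma> p a k t * G p s a)) = \<Gamma> p i k t" for t
  proof -
    have "(\<Sum>s\<in>UNIV. H p i s * (\<Sum>a\<in>UNIV. \<Gamma> p a k t * G p s a))
        = (\<Sum>a\<in>UNIV. (\<Sum>s\<in>UNIV. H p i s * G p s a) * \<Gamma> p a k t)"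
      unfolding sum_sum_assoc by (simp add: mult.commute)
    then show ?thesis by (simp add: metric_inv[OF p])
  qed
  have 2: "(\<Sum>t\<in>UNIV. (\<Sum>a\<in>UNIV. \<Gamma> p a k s * G p a t) * H p t j) = \<Gamma> p j k s" for s
    unfolding sum_sum_assoc by (simp add: metric_inv[OF p])
  have "(\<Sum>t\<in>UNIV. (\<Sum>s\<in>UNIV. H p i s * D k (\<lambda>q. G q s t) p) * H p t j)
     = (\<Sum>t\<in>UNIV. (\<Sum>s\<in>UNIV. H p i s * (\<Sum>a\<in>UNIV. \<Gamma> p a k s * G p a t)) * H p t j)
     + (\<Sum>t\<in>UNIV. (\<Sum>s\<in>UNIV. H p i s * (\<Sum>a\<in>UNIV. \<Gamma> p a k t * G p s a)) * H p t j)"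
    by (simp add: D_metric[OF p] distrib_left distrib_right sum.distrib)
  also have "\<dots> = (\<Sum>s\<in>UNIV. \<Gamma> p j k s * H p i s) + (\<Sum>s\<in>UNIV. \<Gamma> p i k s * H p s j)"
    unfolding 1 by (simp only: sum_sum_assoc) (simp add: metric_inv[OF p] mult.commute)
  finally show ?thesis using D_inv_metric_aux[OF p] by simp
qed

text \<open>The classical derivative of \<open>log sqrt det g\<close>, expressed without
  determinants. Of the three derivatives of the metric, two cancel since \<open>H\<close> is
  symmetric.\<close>

lemma christoffel_trace:
  assumes p: "p \<in> W"
  shows "(\<Sum>m\<in>UNIV. \<Gamma> p m m l) = (\<Sum>m\<in>UNIV. \<Sum>n\<in>UNIV. H p m n * D l (\<lambda>q. G q m n) p) / 2"
proof -
  let ?S = "\<lambda>f. \<Sum>m\<in>UNIV. \<Sum>n\<in>UNIV. H p m n * f m n"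
  have "(\<Sum>m\<in>UNIV. \<Gamma> p m m l) = (?S (\<lambda>m n. D m (\<lambda>q. G q l n) p) + ?S (\<lambda>m n. D l (\<lambda>q. G q m n) p)
      - ?S (\<lambda>m n. D n (\<lambda>q. G q l m) p)) / 2"
    by (simp add: christoffel_def D_metric_sym[OF p, of _ _ l] sum_divide_distrib sum_subtractf
        sum.distrib sum_distrib_left algebra_simps)
  moreover have "?S (\<lambda>m n. D n (\<lambda>q. G q l m) p) = ?S (\<lambda>m n. D m (\<lambda>q. G q l n) p)"
    by (subst sum_swap_UNIV) (simp add: inv_metric_sym[OF p])
  ultimately show ?thesis by simp
qed

text \<open>The trace of the Christoffel symbols is locally a gradient, hence closed. Without its
  potential: second derivatives of the metric commute, and the remaining term \<open>?Q\<close> is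
  the symmetric expression \<open>- tr (H dG H dG)\<close>.\<close>

lemma D_christoffel_trace_sym:
  assumes p: "p \<in> W"
  shows "D k (\<lambda>q. \<Sum>m\<in>UNIV. \<Gamma> q m m l) p = D l (\<lambda>q. \<Sum>m\<in>UNIV. \<Gamma> q m m k) p"
proof -
  let ?dG = "\<lambda>k m n. D k (\<lambda>q. G q m n) p"
  let ?Q = "\<lambda>k l. \<Sum>m\<in>UNIV. \<Sum>n\<in>UNIV. D k (\<lambda>q. H q m n) p * ?dG l m n"
  have D: "D k (\<lambda>q. \<Sum>m\<in>UNIV. \<Gamma> q m m l) p =
      1/2 * ((\<Sum>m\<in>UNIV. \<Sum>n\<in>UNIV. H p m n * D k (D l (\<lambda>q. G q m n)) p) + ?Q k l)" for k l
  proof -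
    have "D k (\<lambda>q. \<Sum>m\<in>UNIV. \<Gamma> q m m l) p =
        D k (\<lambda>q. 1/2 * (\<Sum>m\<in>UNIV. \<Sum>n\<in>UNIV. H q m n * D l (\<lambda>q. G q m n) q)) p"
      by (rule D_cong[OF _ p]) (simp add: christoffel_trace)
    also have "\<dots> = 1/2 * ((\<Sum>m\<in>UNIV. \<Sum>n\<in>UNIV. H p m n * D k (D l (\<lambda>q. G q m n)) p) + ?Q k l)"
      using p by (subst D_cmult) (simp_all add: D_rules sm_rules sum.distrib)
    finally show ?thesis .
  qed
  have Q: "?Q k l = - (\<Sum>m\<in>UNIV. \<Sum>n\<in>UNIV. \<Sum>t\<in>UNIV. \<Sum>s\<in>UNIV. H p m s * ?dG k s t * H p t n * ?dG l m n)" for k l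
    by (simp add: D_inv_metric_aux[OF p] sum_distrib_right sum_negf)
  have "?Q k l = ?Q l k"
    unfolding Q by (subst sum4_reverse) (simp add: inv_metric_sym[OF p] mult_ac)
  moreover have "D k (D l (\<lambda>q. G q m n)) p = D l (D k (\<lambda>q. G q m n)) p" for m n
    by (rule D_commute[OF g_sm p])
  ultimately show ?thesis unfolding D by simp
qed

end

section \<open>Bianchi identity\<close>

context riemannian_region
begin

abbreviation Rm :: "'a \<Rightarrow> 'n \<Rightarrow> 'n \<Rightarrow> 'n \<Rightarrow> 'n \<Rightarrow> real" where "Rm \<equiv> riemann g c"
abbreviation Rc :: "'a \<Rightarrow> 'n \<Rightarrow> 'n \<Rightarrow> real" where "Rc \<equiv> ricci g c"

lemma riemann_antisym: "Rm p j k l m = - Rm p k j l m"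
  by (simp add: riemann_def)

text \<open>Read off from the coordinate formula. The only term that needs more than symmetric
  Christoffel symbols and a swap of sums is the derivative of the Christoffel trace.\<close>

lemma ricci_sym:
  assumes p: "p \<in> W"
  shows "Rc p k l = Rc p l k"
proof -
  let ?\<Gamma> = "\<Gamma> p"
  have R: "Rc p k l = - (D k (\<lambda>q. \<Sum>m\<in>UNIV. \<Gamma> q m m l) p - (\<Sum>m\<in>UNIV. D m (\<lambda>q. \<Gamma> q m k l) p)
      + (\<Sum>m\<in>UNIV. \<Sum>s\<in>UNIV. ?\<Gamma> s m l * ?\<Gamma> m k s) - (\<Sum>m\<in>UNIV. \<Sum>s\<in>UNIV. ?\<Gamma> s k l * ?\<Gamma> m m s))" for k l
    using p by (simp add: ricci_def riemann_def D_rules sm_rules sum.distrib sum_subtractf)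
  have 1: "D m (\<lambda>q. \<Gamma> q m k l) p = D m (\<lambda>q. \<Gamma> q m l k) p" for m
    by (rule D_cong[OF _ p]) (rule christoffel_sym)
  have 2: "(\<Sum>m\<in>UNIV. \<Sum>s\<in>UNIV. ?\<Gamma> s m l * ?\<Gamma> m k s) = (\<Sum>m\<in>UNIV. \<Sum>s\<in>UNIV. ?\<Gamma> s m k * ?\<Gamma> m l s)"
    by (subst sum_swap_UNIV) (simp add: christoffel_sym[OF p, of _ k] christoffel_sym[OF p, of _ l] mult.commute)
  show ?thesis
    unfolding R 2 D_christoffel_trace_sym[OF p, of k l] by (simp add: 1 christoffel_sym[OF p, of _ k l])
qed

text \<open>The Bianchi identity of the connection matrix with indices \<open>l, m\<close>; the
  connection terms acting on the other indices cancel cyclically because the Christoffel symbols are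
  symmetric.\<close>

lemma second_bianchi:
  assumes p: "p \<in> W"
  shows "nabla_tensor31 g (riemann g) c p i j k l m + nabla_tensor31 g (riemann g) c p j k i l m
    + nabla_tensor31 g (riemann g) c p k i j l m = 0"
proof -
  let ?\<Gamma> = "\<Gamma> p"
  \<comment> \<open>Covariant derivative with respect to the indices \<open>l\<close> and
    \<open>m\<close> alone.\<close>
  define E where "E = (\<lambda>i j k. D i (\<lambda>q. Rm q j k l m) p
     - (\<Sum>s\<in>UNIV. ?\<Gamma> s i l * Rm p j k s m) + (\<Sum>s\<in>UNIV. ?\<Gamma> m i s * Rm p j k l s))"
  have N: "nabla_tensor31 g (riemann g) c p i j k l m = E i j k
     - (\<Sum>s\<in>UNIV. ?\<Gamma> s i j * Rm p s k l m) + (\<Sum>s\<in>UNIV. ?\<Gamma> s i k * Rm p s j l m)" for i j k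
    by (simp add: nabla_tensor31_def E_def riemann_antisym[of p j _ l m] sum_negf)
  let ?d = "\<lambda>k m j l. D k (\<lambda>q. \<Gamma> q m j l) p" and ?dd = "\<lambda>i k m j l. D i (D k (\<lambda>q. \<Gamma> q m j l)) p"
  \<comment> \<open>\<open>E\<close> is sorted into second derivatives of the Christoffel symbols,
    products of a symbol with a derivative (\<open>F\<close>), and cubic terms (\<open>K'\<close>
    and \<open>K\<close>). Each group vanishes in the cyclic sum.\<close>
  define F where "F = (\<lambda>i j k s. ?d i s j l * ?\<Gamma> m k s + ?\<Gamma> s j l * ?d i m k s
      - ?d i s k l * ?\<Gamma> m j s - ?\<Gamma> s k l * ?d i m j s
      - ?\<Gamma> s i l * (?d k m j s - ?d j m k s) + ?\<Gamma> m i s * (?d k s j l - ?d j s k l))"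
  define K where "K = (\<lambda>i j k s t. ?\<Gamma> s i l * (?\<Gamma> t j s * ?\<Gamma> m k t - ?\<Gamma> t k s * ?\<Gamma> m j t))"
  define K' where "K' = (\<lambda>i j k s t. ?\<Gamma> m i t * (?\<Gamma> s j l * ?\<Gamma> t k s - ?\<Gamma> s k l * ?\<Gamma> t j s))"
  have E: "E i j k = ?dd i k m j l - ?dd i j m k l + (\<Sum>s\<in>UNIV. F i j k s)
      + (\<Sum>s\<in>UNIV. \<Sum>t\<in>UNIV. K' i j k s t) - (\<Sum>s\<in>UNIV. \<Sum>t\<in>UNIV. K i j k s t)" for i j k
  proof -
    have D: "D i (\<lambda>q. Rm q j k l m) p = ?dd i k m j l - ?dd i j m k l
       + (\<Sum>s\<in>UNIV. ?\<Gamma> s j l * ?d i m k s + ?d i s j l * ?\<Gamma> m k s)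
       - (\<Sum>s\<in>UNIV. ?\<Gamma> s k l * ?d i m j s + ?d i s k l * ?\<Gamma> m j s)"
      using p by (simp add: riemann_def D_rules sm_rules)
    have S1: "(\<Sum>s\<in>UNIV. ?\<Gamma> s i l * Rm p j k s m) = (\<Sum>s\<in>UNIV. ?\<Gamma> s i l * (?d k m j s - ?d j m k s))
        + (\<Sum>s\<in>UNIV. \<Sum>t\<in>UNIV. K i j k s t)"
      by (simp add: riemann_def K_def sum.distrib sum_subtractf sum_distrib_left algebra_simps)
    have "(\<Sum>s\<in>UNIV. \<Sum>t\<in>UNIV. K' i j k s t) = (\<Sum>s\<in>UNIV. \<Sum>t\<in>UNIV. K' i j k t s)"
      by (rule sum_swap_UNIV)
    then have S2: "(\<Sum>s\<in>UNIV. ?\<Gamma> m i s * Rm p j k l s) = (\<Sum>s\<in>UNIV. ?\<Gamma> m i s * (?d k s j l - ?d j s k l))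
        + (\<Sum>s\<in>UNIV. \<Sum>t\<in>UNIV. K' i j k s t)"
      by (simp add: riemann_def K'_def sum.distrib sum_subtractf sum_distrib_left algebra_simps)
    show ?thesis
      unfolding E_def D S1 S2 F_def by (simp add: sum.distrib sum_subtractf algebra_simps)
  qed
  have "(\<Sum>s\<in>UNIV. F i j k s) + (\<Sum>s\<in>UNIV. F j k i s) + (\<Sum>s\<in>UNIV. F k i j s) = 0"
    unfolding sum.distrib[symmetric] by (rule sum.neutral) (simp add: F_def algebra_simps)
  moreover have "K' i j k s t + K' j k i s t + K' k i j s t = K i j k s t + K j k i s t + K k i j s t" for s t
    by (simp add: K_def K'_def algebra_simps)
  then have "(\<Sum>s\<in>UNIV. \<Sum>t\<in>UNIV. K' i j k s t) + (\<Sum>s\<in>UNIV. \<Sum>t\<in>UNIV. K' j k i s t) + (\<Sum>s\<in>UNIV. \<Sum>t\<in>UNIV. K' k i j s t)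
     = (\<Sum>s\<in>UNIV. \<Sum>t\<in>UNIV. K i j k s t) + (\<Sum>s\<in>UNIV. \<Sum>t\<in>UNIV. K j k i s t) + (\<Sum>s\<in>UNIV. \<Sum>t\<in>UNIV. K k i j s t)"
    unfolding sum.distrib[symmetric] by (intro sum.cong refl) blast
  moreover have "?dd i k m j l = ?dd k i m j l" "?dd j k m i l = ?dd k j m i l" "?dd i j m k l = ?dd j i m k l"
    by (rule D_commute[OF christoffel_sm p])+
  ultimately have "E i j k + E j k i + E k i j = 0"
    unfolding E by linarith
  then show ?thesis
    unfolding N by (simp add: christoffel_sym[OF p, of _ j i] christoffel_sym[OF p, of _ k i]
        christoffel_sym[OF p, of _ k j])
qed

text \<open>Contraction commutes with covariant differentiation: the connection terms of the
  contracted lower and upper index cancel after a swap of the sums.\<close>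

lemma nabla_tensor31_trace1:
  assumes p: "p \<in> W" and T: "\<And>j k l m. sm (\<lambda>q. T c q j k l m)"
  shows "(\<Sum>m\<in>UNIV. nabla_tensor31 g T c p i m k l m)
    = nabla_tensor02 g (\<lambda>c q k l. \<Sum>m\<in>UNIV. T c q m k l m) c p i k l"
proof -
  have "(\<Sum>m\<in>UNIV. \<Sum>s\<in>UNIV. \<Gamma> p s i m * T c p s k l m) = (\<Sum>m\<in>UNIV. \<Sum>s\<in>UNIV. \<Gamma> p m i s * T c p m k l s)"
    by (rule sum_swap_UNIV)
  moreover have "(\<Sum>m\<in>UNIV. \<Sum>s\<in>UNIV. \<Gamma> p s i k * T c p m s l m) = (\<Sum>s\<in>UNIV. \<Gamma> p s i k * (\<Sum>m\<in>UNIV. T c p m s l m))"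
    "(\<Sum>m\<in>UNIV. \<Sum>s\<in>UNIV. \<Gamma> p s i l * T c p m k s m) = (\<Sum>s\<in>UNIV. \<Gamma> p s i l * (\<Sum>m\<in>UNIV. T c p m k s m))"
    by (subst sum_swap_UNIV, simp add: sum_distrib_left)+
  ultimately show ?thesis
    using p T by (simp add: nabla_tensor31_def nabla_tensor02_def D_rules sum.distrib sum_subtractf)
qed

lemma nabla_tensor02_minus:
  assumes "p \<in> W" "\<And>j l. sm (\<lambda>q. T c q j l)"
  shows "nabla_tensor02 g (\<lambda>c q j l. - T c q j l) c p k j l = - nabla_tensor02 g T c p k j l"
  using assms by (simp add: nabla_tensor02_def D_rules sum_negf)

lemma nabla_tensor02_sym:
  assumes p: "p \<in> W" and "\<And>q j l. q \<in> W \<Longrightarrow> T c q j l = T c q l j"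
  shows "nabla_tensor02 g T c p k j l = nabla_tensor02 g T c p k l j"
proof -
  have "D k (\<lambda>q. T c q j l) p = D k (\<lambda>q. T c q l j) p"
    by (rule D_cong[OF _ p]) (rule assms)
  with assms show ?thesis by (simp add: nabla_tensor02_def)
qed

lemma nabla_riemann_antisym:
  "p \<in> W \<Longrightarrow> nabla_tensor31 g (riemann g) c p i j k l m = - nabla_tensor31 g (riemann g) c p i k j l m"
proof -
  assume p: "p \<in> W"
  have "D i (\<lambda>q. Rm q j k l m) p = D i (\<lambda>q. - Rm q k j l m) p"
    by (rule D_cong[OF _ p]) (rule riemann_antisym)
  with p show ?thesis
    by (simp add: nabla_tensor31_def D_rules sm_rules riemann_antisym[of p j] riemann_antisym[of p _ k] sum_negf)
qed

text \<open>Trace of the second Bianchi identity over the upper index and one lower index: one term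
  becomes the divergence, the two others are derivatives of the Ricci tensor.\<close>

lemma divergence_riemann:
  assumes p: "p \<in> W"
  shows "(\<Sum>m\<in>UNIV. nabla_tensor31 g (riemann g) c p m j k l m)
    = nabla_tensor02 g (ricci g) c p k j l - nabla_tensor02 g (ricci g) c p j k l"
proof -
  have tr: "(\<Sum>m\<in>UNIV. nabla_tensor31 g (riemann g) c p i m k l m) = - nabla_tensor02 g (ricci g) c p i k l" for i k l
  proof -
    have "nabla_tensor02 g (ricci g) c p i k l = - nabla_tensor02 g (\<lambda>c q k l. \<Sum>m\<in>UNIV. riemann g c q m k l m) c p i k l"
      using nabla_tensor02_minus[OF p, of "\<lambda>c q k l. \<Sum>m\<in>UNIV. riemann g c q m k l m"]
      by (simp add: ricci_def[abs_def] sm_rules)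
    then show ?thesis using nabla_tensor31_trace1[OF p, of "riemann g"] by (simp add: sm_rules)
  qed
  have "(\<Sum>m\<in>UNIV. nabla_tensor31 g (riemann g) c p m j k l m + nabla_tensor31 g (riemann g) c p j k m l m
      + nabla_tensor31 g (riemann g) c p k m j l m) = 0"
    by (rule sum.neutral) (simp add: second_bianchi[OF p])
  moreover have "(\<Sum>m\<in>UNIV. nabla_tensor31 g (riemann g) c p j k m l m) = - (\<Sum>m\<in>UNIV. nabla_tensor31 g (riemann g) c p j m k l m)"
    using nabla_riemann_antisym[OF p, of j k] by (simp add: sum_negf)
  ultimately show ?thesis by (simp add: sum.distrib tr)
qed

end

section \<open>Harmonic conformal curvature\<close>

lemma sum3_swap13:
  "(\<Sum>i\<in>UNIV. \<Sum>j\<in>UNIV. \<Sum>k\<in>UNIV. f i j k)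
    = (\<Sum>i\<in>UNIV. \<Sum>j\<in>UNIV. \<Sum>k\<in>UNIV. (f k j i :: real))"
proof -
  have "(\<Sum>i\<in>UNIV. \<Sum>j\<in>UNIV. \<Sum>k\<in>UNIV. f i j k) = (\<Sum>j\<in>UNIV. \<Sum>i\<in>UNIV. \<Sum>k\<in>UNIV. f i j k)"
    by (rule sum.swap)
  also have "\<dots> = (\<Sum>j\<in>UNIV. \<Sum>i\<in>UNIV. \<Sum>k\<in>UNIV. f k j i)"
    by (intro sum.cong refl sum.swap)
  also have "\<dots> = (\<Sum>i\<in>UNIV. \<Sum>j\<in>UNIV. \<Sum>k\<in>UNIV. f k j i)"
    by (rule sum.swap)
  finally show ?thesis .
qed

lemma sum3_swap23:
  "(\<Sum>i\<in>UNIV. \<Sum>j\<in>UNIV. \<Sum>k\<in>UNIV. f i j k)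
    = (\<Sum>i\<in>UNIV. \<Sum>j\<in>UNIV. \<Sum>k\<in>UNIV. (f i k j :: real))"
  by (intro sum.cong refl sum.swap)

text \<open>Here \<open>x\<close> and \<open>y\<close> are
  \<open>\<nabla>\<^sub>k R\<^sub>j\<^sub>l\<close> and
  \<open>\<nabla>\<^sub>j R\<^sub>k\<^sub>l\<close>, while \<open>a\<close> and \<open>b\<close> are
  derivatives of the scalar curvature and \<open>u\<close> and \<open>v\<close> are metric
  components. Clearing denominators leaves an overall factor \<open>n - 3\<close>, so dimension 3
  has to be excluded.\<close>

lemma codazzi_arith:
  fixes n x y a b u v :: real
  assumes eq: "0 = x - y + 1 / (n - 2) * (y - x + a / 2 * u - b / 2 * v)
      - 1 / ((n - 1) * (n - 2)) * (a * u - b * v)"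
    and n: "n > 3"
  shows "x - y = (b * v - a * u) / (2 * (n - 1))"
proof -
  have cancel: "k * (1 / k * z) = z" if "k \<noteq> 0" for k z :: real
    using that by simp
  have "(n - 1) * (n - 2) * (1 / (n - 2) * z) = (n - 1) * z" for z
    using cancel[of "n - 2"] n by (simp only: mult.assoc)
  moreover have "(n - 1) * (n - 2) * (1 / ((n - 1) * (n - 2)) * z) = z" for z
    using cancel[of "(n - 1) * (n - 2)"] n by simp
  moreover have "0 = (n - 1) * (n - 2) * (x - y)
      + (n - 1) * (n - 2) * (1 / (n - 2) * (y - x + a / 2 * u - b / 2 * v))
      - (n - 1) * (n - 2) * (1 / ((n - 1) * (n - 2)) * (a * u - b * v))"
    using arg_cong[OF eq, of "\<lambda>z. (n - 1) * (n - 2) * z"]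
    by (simp only: distrib_left right_diff_distrib mult_zero_right)
  ultimately have "(n - 1) * (n - 2) * (x - y) + (n - 1) * (y - x + a / 2 * u - b / 2 * v)
      - (a * u - b * v) = 0"
    by simp
  moreover have "(n - 3) * ((x - y) * (2 * (n - 1)) - (b * v - a * u))
      = 2 * ((n - 1) * (n - 2) * (x - y) + (n - 1) * (y - x + a / 2 * u - b / 2 * v) - (a * u - b * v))"
    by (simp add: field_simps)
  ultimately have "(n - 3) * ((x - y) * (2 * (n - 1)) - (b * v - a * u)) = 0" by simp
  then have "(x - y) * (2 * (n - 1)) = b * v - a * u" using n by simp
  then show ?thesis using n by (simp add: eq_divide_eq)
qed

context riemannian_region
begin

abbreviation S :: "'a \<Rightarrow> real" where "S \<equiv> scalar_curv g c"
abbreviation nb2 :: "('a, 'n) tensor02 \<Rightarrow> 'a \<Rightarrow> 'n \<Rightarrow> 'n \<Rightarrow> 'n \<Rightarrow> real" where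
  "nb2 T \<equiv> nabla_tensor02 g T c"
abbreviation div31 :: "('a, 'n) tensor31 \<Rightarrow> 'a \<Rightarrow> 'n \<Rightarrow> 'n \<Rightarrow> 'n \<Rightarrow> real" where
  "div31 T p j k l \<equiv> \<Sum>m\<in>UNIV. nabla_tensor31 g T c p m j k l m"

section \<open>Divergence of the conformal tensor, term by term\<close>

lemma div31_add:
  assumes "p \<in> W" "\<And>j k l m. sm (\<lambda>q. T c q j k l m)" "\<And>j k l m. sm (\<lambda>q. T' c q j k l m)"
  shows "div31 (\<lambda>c q j k l m. T c q j k l m + T' c q j k l m) p j k l = div31 T p j k l + div31 T' p j k l"
  using assms by (simp add: nabla_tensor31_def D_rules sum.distrib sum_subtractf distrib_left)

lemma div31_cmult:
  assumes "p \<in> W" "\<And>j k l m. sm (\<lambda>q. T c q j k l m)"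
  shows "div31 (\<lambda>c q j k l m. a * T c q j k l m) p j k l = a * div31 T p j k l"
proof -
  have "(\<Sum>s\<in>UNIV. x s * (a * y s)) = a * (\<Sum>s\<in>UNIV. x s * y s)" for x y :: "'n \<Rightarrow> real"
    by (simp add: sum_distrib_left mult_ac)
  then show ?thesis
    using assms by (simp add: nabla_tensor31_def D_cmult sum_distrib_left algebra_simps)
qed

lemma div31_diff:
  assumes "p \<in> W" "\<And>j k l m. sm (\<lambda>q. T c q j k l m)" "\<And>j k l m. sm (\<lambda>q. T' c q j k l m)"
  shows "div31 (\<lambda>c q j k l m. T c q j k l m - T' c q j k l m) p j k l = div31 T p j k l - div31 T' p j k l"
  using assms by (simp add: nabla_tensor31_def D_rules sum.distrib sum_subtractf right_diff_distrib)

lemma div31_swap: "div31 (\<lambda>c q j k l m. T c q k j l m) p j k l = div31 T p k j l"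
  by (intro sum.cong refl) (simp add: nabla_tensor31_def)

text \<open>The Kronecker delta is parallel, its two connection terms being equal; contraction with
  it only renames the derivative index.\<close>

lemma div31_kronecker:
  assumes p: "p \<in> W" and X: "\<And>k l. sm (\<lambda>q. X c q k l)"
  shows "div31 (\<lambda>c q j k l m. kronecker j m * X c q k l) p j k l = nb2 X p j k l"
proof -
  have "(\<Sum>m\<in>UNIV. \<Sum>s\<in>UNIV. \<Gamma> p s m j * (kronecker s m * X c p k l)) = (\<Sum>m\<in>UNIV. \<Gamma> p m m j * X c p k l)"
    by (simp add: kronecker_def mult.assoc[symmetric] sum_distrib_right[symmetric])
  moreover have "(\<Sum>m\<in>UNIV. \<Sum>s\<in>UNIV. \<Gamma> p m m s * (kronecker j s * X c p k l)) = (\<Sum>m\<in>UNIV. \<Gamma> p m m j * X c p k l)"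
    by (simp add: kronecker_def mult.assoc[symmetric] sum_distrib_right[symmetric])
  moreover have "(\<Sum>m\<in>UNIV. \<Sum>s\<in>UNIV. \<Gamma> p s m a * (kronecker j m * Y s)) = (\<Sum>s\<in>UNIV. \<Gamma> p s j a * Y s)"
    for Y :: "'n \<Rightarrow> real" and a
    by (subst sum.swap) (simp add: kronecker_def mult.left_commute)
  moreover have "(\<Sum>m\<in>UNIV. kronecker j m * D m (\<lambda>q. X c q k l) p) = D j (\<lambda>q. X c q k l) p"
    by (simp add: kronecker_def)
  ultimately show ?thesis
    using p X by (simp add: nabla_tensor31_def nabla_tensor02_def D_cmult sum.distrib sum_subtractf)
qed

text \<open>The metric is parallel and factors out. The bracket is the divergence of
  \<open>Y\<close> as a mixed tensor with \<open>m\<close> as upper index.\<close>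

lemma div31_metric:
  assumes p: "p \<in> W" and Y: "\<And>k l. sm (\<lambda>q. Y c q k l)"
  shows "div31 (\<lambda>c q j k l m. Y c q j m * g c q k l) p j k l =
    ((\<Sum>m\<in>UNIV. D m (\<lambda>q. Y c q j m) p) - (\<Sum>m\<in>UNIV. \<Sum>s\<in>UNIV. \<Gamma> p s m j * Y c p s m)
      + (\<Sum>m\<in>UNIV. \<Sum>s\<in>UNIV. \<Gamma> p m m s * Y c p j s)) * G p k l"
proof -
  have "nabla_tensor31 g (\<lambda>c q j k l m. Y c q j m * g c q k l) c p m j k l m =
      (D m (\<lambda>q. Y c q j m) p - (\<Sum>s\<in>UNIV. \<Gamma> p s m j * Y c p s m) + (\<Sum>s\<in>UNIV. \<Gamma> p m m s * Y c p j s)) * G p k l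
      + Y c p j m * nb2 g p m k l" for m
    using p by (simp add: nabla_tensor31_def nabla_tensor02_def D_mult Y g_sm sum_distrib_left
        sum_distrib_right algebra_simps)
  then show ?thesis
    by (simp add: nabla_metric[OF p] sum_distrib_right[symmetric] sum.distrib sum_subtractf)
qed

text \<open>The trace commutes with differentiation because the inverse metric is parallel. This is
  applied to the Ricci tensor, to \<open>Z\<close>, and to the square of a unit covector.\<close>

lemma D_trace:
  assumes p: "p \<in> W" and X: "\<And>i j. sm (\<lambda>q. X c q i j)"
  shows "D k (\<lambda>q. \<Sum>i\<in>UNIV. \<Sum>j\<in>UNIV. H q i j * X c q i j) p = (\<Sum>i\<in>UNIV. \<Sum>j\<in>UNIV. H p i j * nb2 X p k i j)"
proof -
  have "(\<Sum>i\<in>UNIV. \<Sum>j\<in>UNIV. \<Sum>s\<in>UNIV. \<Gamma> p i k s * H p s j * X c p i j)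
      = (\<Sum>i\<in>UNIV. \<Sum>j\<in>UNIV. \<Sum>s\<in>UNIV. \<Gamma> p s k i * H p i j * X c p s j)"
    by (rule sum3_swap13)
  moreover have "(\<Sum>i\<in>UNIV. \<Sum>j\<in>UNIV. \<Sum>s\<in>UNIV. \<Gamma> p j k s * H p i s * X c p i j)
      = (\<Sum>i\<in>UNIV. \<Sum>j\<in>UNIV. \<Sum>s\<in>UNIV. \<Gamma> p s k j * H p i j * X c p i s)"
    by (rule sum3_swap23)
  ultimately show ?thesis
    using p X by (simp add: D_rules sm_rules D_inv_metric nabla_tensor02_def sum.distrib sum_subtractf
        sum_distrib_left sum_distrib_right sum_negf algebra_simps)
qed

lemma div31_ricci_mixed:
  assumes p: "p \<in> W"
  shows "div31 (\<lambda>c q j k l m. ricci_mixed g c q j m * g c q k l) p j k l =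
    (\<Sum>m\<in>UNIV. \<Sum>s\<in>UNIV. H p m s * nb2 (ricci g) p m j s) * G p k l"
proof -
  have "(\<Sum>m\<in>UNIV. \<Sum>s\<in>UNIV. \<Sum>t\<in>UNIV. \<Gamma> p m m t * H p t s * Rc p j s)
      = (\<Sum>m\<in>UNIV. \<Sum>s\<in>UNIV. \<Sum>t\<in>UNIV. \<Gamma> p m m s * H p s t * Rc p j t)"
    by (rule sum3_swap23)
  moreover have "(\<Sum>m\<in>UNIV. \<Sum>s\<in>UNIV. \<Sum>t\<in>UNIV. \<Gamma> p s m t * H p m t * Rc p j s)
      = (\<Sum>m\<in>UNIV. \<Sum>s\<in>UNIV. \<Sum>t\<in>UNIV. \<Gamma> p t m s * H p m s * Rc p j t)"
    by (rule sum3_swap23)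
  moreover have "(\<Sum>m\<in>UNIV. \<Sum>s\<in>UNIV. \<Sum>t\<in>UNIV. \<Gamma> p s m j * H p m t * Rc p s t)
      = (\<Sum>m\<in>UNIV. \<Sum>s\<in>UNIV. \<Sum>t\<in>UNIV. \<Gamma> p t m j * H p m s * Rc p t s)"
    by (rule sum3_swap23)
  ultimately have "(\<Sum>m\<in>UNIV. D m (\<lambda>q. ricci_mixed g c q j m) p) - (\<Sum>m\<in>UNIV. \<Sum>s\<in>UNIV. \<Gamma> p s m j * ricci_mixed g c p s m)
      + (\<Sum>m\<in>UNIV. \<Sum>s\<in>UNIV. \<Gamma> p m m s * ricci_mixed g c p j s)
    = (\<Sum>m\<in>UNIV. \<Sum>s\<in>UNIV. H p m s * nb2 (ricci g) p m j s)"
    using p by (simp add: ricci_mixed_def D_rules sm_rules D_inv_metric nabla_tensor02_def sum.distrib sum_subtractf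
        sum_distrib_left sum_distrib_right sum_negf algebra_simps)
  then show ?thesis using div31_metric[OF p, of "ricci_mixed g"] ricci_mixed_sm by simp
qed

text \<open>\<open>f\<close> depends on the chart so that \<open>scalar_curv g\<close>, defined
  chartwise, can be inserted.\<close>

lemma nabla_scalar_metric:
  assumes p: "p \<in> W" and f: "sm (f c)"
  shows "nb2 (\<lambda>c q k l. f c q * g c q k l) p j k l = D j (f c) p * G p k l"
proof -
  have "nb2 (\<lambda>c q k l. f c q * g c q k l) p j k l = D j (f c) p * G p k l + f c p * nb2 g p j k l"
    using p f by (simp add: nabla_tensor02_def D_mult g_sm sum_distrib_left algebra_simps)
  then show ?thesis by (simp add: nabla_metric[OF p])
qed

text \<open>By linearity from the divergences of the Riemann tensor, \<open>?U\<close>,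
  \<open>?V\<close> and \<open>?X\<close>. The divergence \<open>d\<close> of the Ricci tensor is
  left as it is; \<open>codazzi_ricci\<close> determines it.\<close>

lemma div31_conformal:
  assumes p: "p \<in> W"
  defines "n \<equiv> real CARD('n)" and "N \<equiv> nb2 (ricci g) p"
    and "d \<equiv> \<lambda>j. \<Sum>m\<in>UNIV. \<Sum>s\<in>UNIV. H p m s * nb2 (ricci g) p m j s"
  shows "div31 (conformal_curv g) p j k l = N k j l - N j k l
    + 1 / (n - 2) * (N j k l - N k j l + d j * G p k l - d k * G p j l)
    - 1 / ((n - 1) * (n - 2)) * (D j S p * G p k l - D k S p * G p j l)"
proof -
  let ?U = "\<lambda>c q j k l m. kronecker j m * ricci g c q k l"
  let ?V = "\<lambda>c q j k l m. ricci_mixed g c q j m * g c q k l"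
  let ?X = "\<lambda>c q j k l m. kronecker j m * (scalar_curv g c q * g c q k l)"
  have X: "div31 ?X p j k l = D j S p * G p k l" for j k
    using div31_kronecker[OF p, of "\<lambda>c q k l. scalar_curv g c q * g c q k l"]
      nabla_scalar_metric[of p "scalar_curv g"] p by (simp add: sm_rules)
  have "div31 (conformal_curv g) p j k l = div31 (\<lambda>c q j k l m. (riemann g c q j k l m
      + 1 / (n - 2) * (?U c q j k l m - ?U c q k j l m + ?V c q j k l m - ?V c q k j l m))
      - 1 / ((n - 1) * (n - 2)) * (?X c q j k l m - ?X c q k j l m)) p j k l"
    by (rule arg_cong[of _ _ "\<lambda>T. div31 T p j k l"], intro ext)
      (simp add: conformal_curv_def Let_def n_def[symmetric] diff_divide_distrib algebra_simps)
  also have "\<dots> = div31 (riemann g) p j k l + 1 / (n - 2) *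
      (div31 ?U p j k l - div31 ?U p k j l + div31 ?V p j k l - div31 ?V p k j l)
      - 1 / ((n - 1) * (n - 2)) * (div31 ?X p j k l - div31 ?X p k j l)"
    by (simp only: div31_add div31_diff div31_cmult p sm_rules div31_swap[of ?U] div31_swap[of ?V] div31_swap[of ?X])
  finally show ?thesis
    unfolding X div31_ricci_mixed[OF p] divergence_riemann[OF p] N_def d_def
      using div31_kronecker[OF p, of "ricci g"] ricci_sm by simp
qed

lemma metric_trace: "p \<in> W \<Longrightarrow> (\<Sum>j\<in>UNIV. \<Sum>l\<in>UNIV. H p j l * G p j l) = real CARD('n)"
  using metric_inv(2)[of p] g_sym[of p] by simp

lemma trace_covector_metric:
  assumes p: "p \<in> W"
  shows "(\<Sum>j\<in>UNIV. \<Sum>l\<in>UNIV. H p j l * (x j * G p k l)) = x k"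
proof -
  have "(\<Sum>l\<in>UNIV. H p j l * (x j * G p k l)) = x j * (\<Sum>l\<in>UNIV. H p j l * G p l k)" for j
    by (simp add: sum_distrib_left g_sym[OF p, of k] mult.left_commute)
  then show ?thesis by (simp add: metric_inv[OF p])
qed

text \<open>The identity \<open>\<nabla>\<^sub>m R\<^sub>k\<^sup>m = \<nabla>\<^sub>k R / 2\<close> does not have to be derived from the Bianchi identity: it is the
  trace of the hypothesis.\<close>
lemma codazzi_ricci:
  assumes p: "p \<in> W" and n: "CARD('n) > 3"
    and harmonic: "\<And>j k l. div31 (conformal_curv g) p j k l = 0"
  shows "nb2 (ricci g) p k j l - nb2 (ricci g) p j k l
    = (D k S p * G p j l - D j S p * G p k l) / (2 * (real CARD('n) - 1))"
proof -
  define n where "n = real CARD('n)"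
  have n3: "n > 3" using n by (simp add: n_def)
  let ?N = "nb2 (ricci g) p"
  define d where "d = (\<lambda>j. \<Sum>m\<in>UNIV. \<Sum>s\<in>UNIV. H p m s * ?N m j s)"
  have eq: "0 = ?N k j l - ?N j k l + 1 / (n - 2) * (?N j k l - ?N k j l + d j * G p k l - d k * G p j l)
    - 1 / ((n - 1) * (n - 2)) * (D j S p * G p k l - D k S p * G p j l)" for j k l
    using div31_conformal[OF p, of j k l] harmonic[of j k l] by (simp only: n_def d_def)
  let ?tr = "\<lambda>f. \<Sum>j\<in>UNIV. \<Sum>l\<in>UNIV. H p j l * f j l"
  have DS: "?tr (?N k) = D k S p" for k
    using D_trace[OF p, of "ricci g"] by (simp add: ricci_sm scalar_curv_def[abs_def])
  have tr_d: "?tr (\<lambda>j l. ?N j k l) = d k" for k by (simp add: d_def)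
  have trG: "?tr (\<lambda>j l. x * G p j l) = x * n" for x
    using metric_trace[OF p] by (simp add: n_def mult.left_commute sum_distrib_left[symmetric])
  \<comment> \<open>In the trace over \<open>j, l\<close> the two Ricci terms become
    \<open>D k S p\<close> and \<open>d k\<close>, and the equation collapses to
    \<open>(n - 2) * (D k S p - 2 * d k) = 0\<close>.\<close>
  have d: "D k S p = 2 * d k" for k
  proof -
    have "0 = ?tr (\<lambda>j l. 0)" by simp
    also have "\<dots> = ?tr (\<lambda>j l. ?N k j l - ?N j k l
        + 1 / (n - 2) * (?N j k l - ?N k j l + d j * G p k l - d k * G p j l)
        - 1 / ((n - 1) * (n - 2)) * (D j S p * G p k l - D k S p * G p j l))"
      by (intro sum.cong refl arg_cong2[of _ _ _ _ "(*)"] eq)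
    also have "\<dots> = ?tr (?N k) - ?tr (\<lambda>j l. ?N j k l) + 1 / (n - 2) * (?tr (\<lambda>j l. ?N j k l) - ?tr (?N k)
        + ?tr (\<lambda>j l. d j * G p k l) - ?tr (\<lambda>j l. d k * G p j l))
        - 1 / ((n - 1) * (n - 2)) * (?tr (\<lambda>j l. D j S p * G p k l) - ?tr (\<lambda>j l. D k S p * G p j l))"
      by (simp only: sum_distrib_left sum.distrib sum_subtractf distrib_left right_diff_distrib mult.left_commute)
    also have "\<dots> = D k S p - d k + 1 / (n - 2) * (d k - D k S p + d k - d k * n)
        - 1 / ((n - 1) * (n - 2)) * (D k S p - D k S p * n)"
      unfolding DS tr_d trG trace_covector_metric[OF p] ..
    also have "1 / ((n - 1) * (n - 2)) * (D k S p - D k S p * n) = - D k S p / (n - 2)"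
      using n3 by (simp add: divide_simps) (simp add: algebra_simps)
    finally have "0 = (D k S p - d k) * (n - 2) + (2 * d k - D k S p - d k * n) + D k S p"
      using n3 by (simp add: divide_simps)
    then have "(n - 2) * (D k S p - 2 * d k) = 0" by (simp add: algebra_simps)
    then show ?thesis using n3 by simp
  qed
  have dS: "d k = D k S p / 2" for k using d[of k] by simp
  show ?thesis
    using codazzi_arith[OF eq[of k j l, unfolded dS] n3]
    by (simp add: n_def)
qed

end

section \<open>Weak Z symmetry in a chart\<close>

text \<open>Inserting \<open>wzs\<close> into \<open>codazzi\<close> and contracting in \<open>j, l\<close> with \<open>\<tau> \<otimes> \<tau>\<close> and with \<open>H\<close> gives equal left-hand
  sides, but \<open>w\<close> (up to a multiple of \<open>T\<close>) and \<open>(n - 1) w\<close> on the right; hence \<open>w = 0\<close>.\<close>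
lemma parallel_algebra:
  fixes G H dT :: "'n::finite \<Rightarrow> 'n \<Rightarrow> real" and T \<tau> A B D d\<phi> d\<sigma> w :: "'n \<Rightarrow> real"
    and \<sigma> n b :: real
  assumes \<tau>T: "(\<Sum>l\<in>UNIV. \<tau> l * T l) = 1"
    and \<tau>G: "\<And>j. (\<Sum>l\<in>UNIV. \<tau> l * G j l) = T j"
    and \<tau>dT: "\<And>k. (\<Sum>l\<in>UNIV. \<tau> l * dT k l) = 0"
    and tr\<tau>: "\<And>x. (\<Sum>j\<in>UNIV. \<Sum>l\<in>UNIV. H j l * (x j * T l)) = (\<Sum>l\<in>UNIV. \<tau> l * x l)"
    and trG: "(\<Sum>j\<in>UNIV. \<Sum>l\<in>UNIV. H j l * G j l) = n"
    and trx: "\<And>x k. (\<Sum>j\<in>UNIV. \<Sum>l\<in>UNIV. H j l * (x j * G k l)) = x k"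
    and wzs: "\<And>k j l. d\<sigma> k * T j * T l + \<sigma> * (dT k j * T l + T j * dT k l)
      = A k * (\<sigma> * T j * T l) + B j * (\<sigma> * T k * T l) + D l * (\<sigma> * T k * T j)"
    and codazzi: "\<And>k j l. (d\<sigma> k * T j * T l + \<sigma> * (dT k j * T l + T j * dT k l))
      - (d\<sigma> j * T k * T l + \<sigma> * (dT j k * T l + T k * dT j l)) = w k * G j l - w j * G k l"
    and w: "\<And>k. w k = b * ((n - 2) * d\<phi> k + d\<sigma> k)"
    and b: "b \<noteq> 0" and n: "n > 2" and \<sigma>: "\<sigma> \<noteq> 0"
    and \<phi>: "\<And>j k. T j * d\<phi> k = T k * d\<phi> j"
  shows "dT k l = 0"
proof -
  define ct where "ct = (\<lambda>x. \<Sum>l\<in>UNIV. \<tau> l * x l)"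
  have ct_lin: "ct (\<lambda>l. x l + y l) = ct x + ct y" "ct (\<lambda>l. x l - y l) = ct x - ct y"
    "ct (\<lambda>l. r * x l) = r * ct x" "ct (\<lambda>l. x l * r) = ct x * r" for x y r
    by (simp_all add: ct_def distrib_left right_diff_distrib sum.distrib sum_subtractf sum_distrib_left
        sum_distrib_right mult.left_commute mult.assoc)
  have ct: "ct T = 1" "ct (G j) = T j" "ct (dT k) = 0" for j k
    using \<tau>T \<tau>G \<tau>dT by (simp_all add: ct_def)
  have tr_ct: "(\<Sum>j\<in>UNIV. \<Sum>l\<in>UNIV. H j l * (x j * T l)) = ct x" for x
    using tr\<tau> by (simp add: ct_def)
  \<comment> \<open>Antisymmetrizing \<open>wzs\<close> in \<open>k, j\<close> removes
    \<open>D\<close> and leaves only \<open>A - B\<close>.\<close>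
  define \<alpha> where "\<alpha> = (\<lambda>k. A k - B k)"
  have c1: "\<sigma> * (\<alpha> k * T j - \<alpha> j * T k) * T l = w k * G j l - w j * G k l" for k j l
    using codazzi[of k j l] unfolding wzs \<alpha>_def by (simp add: algebra_simps)
  have "ct (\<lambda>l. \<sigma> * (\<alpha> k * T j - \<alpha> j * T k) * T l) = ct (\<lambda>l. w k * G j l - w j * G k l)" for k j
    by (simp only: c1)
  then have c2: "\<sigma> * (\<alpha> k * T j - \<alpha> j * T k) = w k * T j - w j * T k" for k j
    by (simp only: ct_lin ct mult_1_right)
  have "ct (\<lambda>j. \<sigma> * (\<alpha> k * T j - \<alpha> j * T k)) = ct (\<lambda>j. w k * T j - w j * T k)" for k
    by (simp only: c2)
  then have c3: "\<sigma> * (\<alpha> k - ct \<alpha> * T k) = w k - ct w * T k" for k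
    by (simp only: ct_lin ct mult_1_right)
  have c4: "\<sigma> * (\<alpha> k - ct \<alpha> * T k) = n * w k - w k" for k
  proof -
    have "(\<Sum>j\<in>UNIV. \<Sum>l\<in>UNIV. H j l * ((\<sigma> * (\<alpha> k * T j - \<alpha> j * T k)) * T l))
        = (\<Sum>j\<in>UNIV. \<Sum>l\<in>UNIV. H j l * (w k * G j l - w j * G k l))"
      by (simp only: c1)
    also have "\<dots> = w k * (\<Sum>j\<in>UNIV. \<Sum>l\<in>UNIV. H j l * G j l) - (\<Sum>j\<in>UNIV. \<Sum>l\<in>UNIV. H j l * (w j * G k l))"
      by (simp add: right_diff_distrib sum_subtractf sum_distrib_left mult.left_commute)
    also have "\<dots> = n * w k - w k" unfolding trG trx by simp
    finally show ?thesis
      unfolding tr_ct by (simp only: ct_lin ct mult_1_right)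
  qed
  \<comment> \<open>The left-hand sides of \<open>c3\<close> and \<open>c4\<close> agree, so
    \<open>w\<close> is a multiple of \<open>T\<close>; one more contraction shows that the multiple
    is zero.\<close>
  have c5: "(n - 2) * w k = - ct w * T k" for k
    using c3[of k] c4[of k] by (simp add: algebra_simps)
  then have "ct (\<lambda>k. (n - 2) * w k) = ct (\<lambda>k. - ct w * T k)" by (simp only: )
  then have "(n - 1) * ct w = 0" unfolding ct_lin ct by (simp add: algebra_simps)
  then have "ct w = 0" using n by simp
  with c5 n have w0: "w k = 0" for k by simp
  \<comment> \<open>With \<open>w = 0\<close> the hypothesis that \<open>d\<phi>\<close> is parallel
    to \<open>T\<close> passes on to \<open>d\<sigma>\<close>.\<close>
  have d\<sigma>: "d\<sigma> k = (2 - n) * d\<phi> k" for k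
  proof -
    have "(n - 2) * d\<phi> k + d\<sigma> k = 0" using w[of k] w0[of k] b by simp
    then show ?thesis by (simp add: algebra_simps)
  qed
  have d\<sigma>_T: "d\<sigma> k * T j = d\<sigma> j * T k" for j k
    unfolding d\<sigma> using \<phi>[of j k] by (simp add: algebra_simps)
  have "ct (\<lambda>l. d\<sigma> k * T j * T l + \<sigma> * (dT k j * T l + T j * dT k l)) =
    ct (\<lambda>l. d\<sigma> j * T k * T l + \<sigma> * (dT j k * T l + T k * dT j l))" for k j
    using codazzi[of k j] unfolding w0 by simp
  then have c5: "d\<sigma> k * T j + \<sigma> * dT k j = d\<sigma> j * T k + \<sigma> * dT j k" for k j
    by (simp add: ct_lin ct)
  \<comment> \<open>The terms in \<open>d\<sigma>\<close> are symmetric now, hence so is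
    \<open>dT\<close>: the covector \<open>T\<close> is closed.\<close>
  have sym: "dT k j = dT j k" for k j
    using c5[of k j] d\<sigma>_T[of k j] \<sigma> by simp
  have "ct (\<lambda>l. d\<sigma> k * T j * T l + \<sigma> * (dT k j * T l + T j * dT k l)) =
    ct (\<lambda>l. A k * (\<sigma> * T j * T l) + B j * (\<sigma> * T k * T l) + D l * (\<sigma> * T k * T j))" for k j
    by (simp only: wzs)
  then have c6: "d\<sigma> k * T j + \<sigma> * dT k j = A k * \<sigma> * T j + \<sigma> * B j * T k + ct D * \<sigma> * T k * T j" for k j
    by (simp add: ct_lin ct mult.assoc)
  \<comment> \<open>The derivative index is contracted here. As \<open>dT\<close> is symmetric, its
    contraction vanishes in this index too, and the result is that \<open>B\<close> is a multiple of
    \<open>T\<close>.\<close>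
  have "ct (\<lambda>k. d\<sigma> k * T j + \<sigma> * dT j k) = ct (\<lambda>k. A k * \<sigma> * T j + \<sigma> * B j * T k + ct D * \<sigma> * T k * T j)" for j
    using c6[of _ j] sym[of j] by simp
  then have c7: "\<sigma> * B j = (ct d\<sigma> - ct A * \<sigma> - ct D * \<sigma>) * T j" for j
    unfolding ct_lin ct by (simp add: algebra_simps)
  \<comment> \<open>Now \<open>\<sigma> dT\<close> becomes \<open>s \<otimes> T\<close>, while
    \<open>dT\<close> vanishes when its second index is contracted with \<open>\<tau>\<close>; so
    \<open>s = 0\<close>.\<close>
  define s where "s = (\<lambda>k. A k * \<sigma> + (ct d\<sigma> - ct A * \<sigma>) * T k - d\<sigma> k)"
  have c8: "\<sigma> * dT k j = s k * T j" for k j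
    using c6[of k j] unfolding c7[of j] s_def by (simp add: algebra_simps)
  have "ct (\<lambda>j. \<sigma> * dT k j) = ct (\<lambda>j. s k * T j)" for k by (simp only: c8)
  then have "s k = 0" for k by (simp add: ct_lin ct)
  with c8[of k l] \<sigma> show ?thesis by simp
qed

text \<open>Passage from the Ricci tensor to \<open>Z\<close>: \<open>d - n * f\<close> is the
  derivative of the scalar curvature in terms of \<open>d\<sigma>\<close> and
  \<open>d\<phi>\<close>, and adding \<open>f\<close> produces the coefficient
  \<open>(n - 2) * f + d\<close> over \<open>2 * (n - 1)\<close>. This is the \<open>w\<close> of
  \<open>parallel_algebra\<close>.\<close>

lemma wzs_codazzi_arith:
  fixes n x y d d' f f' u v :: real
  assumes "x - y = ((d - n * f) * u - (d' - n * f') * v) / (2 * (n - 1))" and n: "n \<noteq> 1"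
  shows "(x + f * u) - (y + f' * v) = 1 / (2 * (n - 1)) * ((n - 2) * f + d) * u
    - 1 / (2 * (n - 1)) * ((n - 2) * f' + d') * v"
proof -
  define b where "b = 1 / (2 * (n - 1))"
  have "z = b * (2 * (n - 1)) * z" for z using n by (simp add: b_def)
  from this[of "f * u"] this[of "f' * v"]
  have "(x + f * u) - (y + f' * v) = (x - y) + b * (2 * (n - 1)) * (f * u) - b * (2 * (n - 1)) * (f' * v)"
    by linarith
  moreover have "x - y = b * ((d - n * f) * u - (d' - n * f') * v)"
    using assms(1) by (simp add: b_def)
  ultimately show ?thesis unfolding b_def[symmetric] by (simp add: algebra_simps)
qed

section \<open>Raised indices and unit covectors\<close>

context riemannian_region
begin

abbreviation raise :: "('n \<Rightarrow> real) \<Rightarrow> 'a \<Rightarrow> 'n \<Rightarrow> real" where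
  "raise X q l \<equiv> \<Sum>i\<in>UNIV. H q l i * X i"

lemma lower_raise:
  assumes p: "p \<in> W"
  shows "(\<Sum>l\<in>UNIV. raise X p l * G p j l) = X j"
proof -
  have "(\<Sum>l\<in>UNIV. raise X p l * G p j l) = (\<Sum>l\<in>UNIV. G p j l * raise X p l)"
    by (simp add: mult.commute)
  also have "\<dots> = X j"
    unfolding sum_sum_assoc[symmetric] by (simp add: metric_inv[OF p])
  finally show ?thesis .
qed

lemma trace_raise:
  assumes p: "p \<in> W"
  shows "(\<Sum>j\<in>UNIV. \<Sum>l\<in>UNIV. H p j l * (x j * X l)) = (\<Sum>l\<in>UNIV. raise X p l * x l)"
  by (simp add: sum_distrib_right sum_distrib_left algebra_simps)

text \<open>Derivative of the constant squared length, taken through \<open>D_trace\<close> for the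
  tensor \<open>T \<otimes> T\<close>; by symmetry it is twice the contraction in question.\<close>

lemma nabla_unit_covector:
  assumes p: "p \<in> W" and T: "\<And>i. sm (\<lambda>q. T c q i)"
    and unit: "\<And>q. q \<in> W \<Longrightarrow> (\<Sum>i\<in>UNIV. \<Sum>j\<in>UNIV. H q i j * (T c q i * T c q j)) = 1"
  shows "(\<Sum>l\<in>UNIV. raise (T c p) p l * nabla_covector g T c p k l) = 0"
proof -
  let ?X = "\<lambda>c q i j. T c q i * T c q j"
  let ?N = "nabla_covector g T c p k"
  have N: "nb2 ?X p k i j = ?N i * T c p j + ?N j * T c p i" for i j
    using p T by (simp add: nabla_tensor02_def nabla_covector_def D_mult sum_distrib_left algebra_simps)
  have "0 = D k (\<lambda>q. \<Sum>i\<in>UNIV. \<Sum>j\<in>UNIV. H q i j * ?X c q i j) p"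
  proof -
    have "D k (\<lambda>q. \<Sum>i\<in>UNIV. \<Sum>j\<in>UNIV. H q i j * ?X c q i j) p = D k (\<lambda>q. 1) p"
      by (rule D_cong[OF _ p]) (rule unit)
    then show ?thesis by simp
  qed
  also have "\<dots> = (\<Sum>i\<in>UNIV. \<Sum>j\<in>UNIV. H p i j * (?N i * T c p j)) + (\<Sum>i\<in>UNIV. \<Sum>j\<in>UNIV. H p i j * (?N j * T c p i))"
    using D_trace[OF p, of ?X k] T by (simp add: N sm_mult distrib_left sum.distrib)
  also have "(\<Sum>i\<in>UNIV. \<Sum>j\<in>UNIV. H p i j * (?N j * T c p i)) = (\<Sum>i\<in>UNIV. \<Sum>j\<in>UNIV. H p i j * (?N i * T c p j))"
    by (subst sum_swap_UNIV) (simp add: inv_metric_sym[OF p])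
  finally show ?thesis unfolding trace_raise[OF p] by simp
qed

lemma covector_norm_sm:
  assumes X: "\<And>i. sm (\<lambda>q. X c q i)" and nz: "\<And>q. q \<in> W \<Longrightarrow> \<exists>k. X c q k \<noteq> 0"
  shows "sm (covector_norm g X c)"
  unfolding covector_norm_def[abs_def]
proof (rule sm_sqrt)
  show "0 < (\<Sum>i\<in>UNIV. \<Sum>j\<in>UNIV. H q i j * X c q i * X c q j)" if "q \<in> W" for q
    using inv_metric_pos[OF that, of "X c q"] nz[OF that] by blast
qed (intro sm_sum sm_mult inv_metric_sm X)

lemma covector_norm_pos: "q \<in> W \<Longrightarrow> X c q k \<noteq> 0 \<Longrightarrow> covector_norm g X c q > 0"
  using inv_metric_pos[of q "X c q" k] by (simp add: covector_norm_def)

lemma normalized_covector_sm: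
  assumes X: "\<And>i. sm (\<lambda>q. X c q i)" and nz: "\<And>q. q \<in> W \<Longrightarrow> \<exists>k. X c q k \<noteq> 0"
  shows "sm (\<lambda>q. normalized_covector g X c q i)"
  unfolding normalized_covector_def
proof (rule sm_divide)
  show "sm (covector_norm g X c)" by (rule covector_norm_sm[of X]) (use X nz in auto)
  show "covector_norm g X c q \<noteq> 0" if "q \<in> W" for q
    using covector_norm_pos[OF that, of X] nz[OF that] by force
qed (rule X)

lemma normalized_covector_unit:
  assumes q: "q \<in> W" and nz: "X c q k \<noteq> 0"
  shows "(\<Sum>i\<in>UNIV. \<Sum>j\<in>UNIV. H q i j * (normalized_covector g X c q i * normalized_covector g X c q j)) = 1"
proof -
  let ?N = "covector_norm g X c q"
  have "(\<Sum>i\<in>UNIV. \<Sum>j\<in>UNIV. H q i j * X c q i * X c q j) = ?N\<^sup>2"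
    using inv_metric_pos[of q "X c q" k] q nz by (simp add: covector_norm_def)
  moreover have "(\<Sum>i\<in>UNIV. \<Sum>j\<in>UNIV. H q i j * (normalized_covector g X c q i * normalized_covector g X c q j))
      = (\<Sum>i\<in>UNIV. \<Sum>j\<in>UNIV. H q i j * X c q i * X c q j) / ?N\<^sup>2"
    by (simp add: normalized_covector_def sum_divide_distrib power2_eq_square mult.assoc)
  moreover have "?N\<^sup>2 \<noteq> 0" using covector_norm_pos[of q X k] q nz by simp
  ultimately show ?thesis by simp
qed

end

text \<open>The covector \<open>D\<close> of the theorem is called \<open>D'\<close>, as
  \<open>D\<close> denotes coordinate derivatives here.\<close>

locale wzs_region = riemannian_region c W g
  for c :: "('a::topological_space, 'n::finite) chart" and W :: "'a set" and g :: "('a, 'n) tensor02" +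
  fixes \<phi> :: "'a \<Rightarrow> real" and A B D' :: "('a, 'n) covector"
  assumes \<phi>_sm: "sm \<phi>" and A_sm: "sm (\<lambda>q. A c q i)" and B_sm: "sm (\<lambda>q. B c q i)" and D_sm: "sm (\<lambda>q. D' c q i)"
    and wzs: "q \<in> W \<Longrightarrow> nb2 (Z_tensor g \<phi>) q k j l = A c q k * Z_tensor g \<phi> c q j l
      + B c q j * Z_tensor g \<phi> c q k l + D' c q l * Z_tensor g \<phi> c q k j"
    and \<eta>_nz: "q \<in> W \<Longrightarrow> \<exists>k. covector_diff B D' c q k \<noteq> 0"
begin

abbreviation Z :: "'a \<Rightarrow> 'n \<Rightarrow> 'n \<Rightarrow> real" where "Z \<equiv> Z_tensor g \<phi> c"
abbreviation \<eta> :: "('a, 'n) covector" where "\<eta> \<equiv> covector_diff B D'"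
abbreviation T :: "'a \<Rightarrow> 'n \<Rightarrow> real" where "T \<equiv> normalized_covector g \<eta> c"
abbreviation \<tau> :: "'a \<Rightarrow> 'n \<Rightarrow> real" where "\<tau> q \<equiv> raise (T q) q"

definition \<sigma> :: "'a \<Rightarrow> real" where
  "\<sigma> q = (\<Sum>i\<in>UNIV. \<Sum>j\<in>UNIV. H q i j * Z q i j)"

lemma Z_sm: "sm (\<lambda>q. Z q i j)"
  unfolding Z_tensor_def by (intro sm_add sm_mult \<phi>_sm field_sm)

lemma \<sigma>_sm: "sm \<sigma>"
  unfolding \<sigma>_def[abs_def] by (intro sm_sum sm_mult inv_metric_sm Z_sm)

lemma \<eta>_sm: "sm (\<lambda>q. \<eta> c q i)"
  unfolding covector_diff_def by (intro sm_diff B_sm D_sm)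

lemma T_sm: "sm (\<lambda>q. T q i)"
  by (rule normalized_covector_sm[of \<eta>, OF \<eta>_sm \<eta>_nz])

lemma \<tau>_sm: "sm (\<lambda>q. \<tau> q i)"
  by (intro sm_sum sm_mult T_sm inv_metric_sm)

lemma T_unit: "q \<in> W \<Longrightarrow> (\<Sum>i\<in>UNIV. \<Sum>j\<in>UNIV. H q i j * (T q i * T q j)) = 1"
  using \<eta>_nz normalized_covector_unit[of q \<eta>] by blast

lemma \<tau>_T: "q \<in> W \<Longrightarrow> (\<Sum>l\<in>UNIV. \<tau> q l * T q l) = 1"
  using T_unit[of q] trace_raise[of q "T q" "T q"] by simp

lemma Z_sym: "q \<in> W \<Longrightarrow> Z q i j = Z q j i"
  by (simp add: Z_tensor_def ricci_sym g_sym)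

text \<open>In \<open>wzs\<close> the left-hand side and the term of \<open>A\<close> are symmetric
  in \<open>j, l\<close>, so swapping these indices leaves a relation in \<open>B - D'\<close>
  alone.\<close>

lemma T_Z:
  assumes q: "q \<in> W"
  shows "T q j * Z q k l = T q l * Z q k j"
proof -
  have "nb2 (Z_tensor g \<phi>) q k j l = nb2 (Z_tensor g \<phi>) q k l j"
    by (rule nabla_tensor02_sym[OF q]) (rule Z_sym)
  then have "\<eta> c q j * Z q k l = \<eta> c q l * Z q k j"
    using Z_sym[OF q, of k] by (simp add: wzs[OF q] Z_sym[OF q, of l j] covector_diff_def algebra_simps)
  then show ?thesis by (simp add: normalized_covector_def)
qed

text \<open>Contracting \<open>T_Z\<close> with \<open>\<tau>\<close> factors \<open>T q l\<close>
  out of \<open>Z\<close>; symmetry of \<open>Z\<close> then makes the other factor a multiple of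
  \<open>T\<close>, and the trace identifies the multiple as \<open>\<sigma>\<close>.\<close>

lemma Z_rank_one:
  assumes q: "q \<in> W"
  shows "Z q k l = \<sigma> q * T q k * T q l"
proof -
  define z where "z = (\<lambda>k. \<Sum>j\<in>UNIV. \<tau> q j * Z q k j)"
  define \<zeta> where "\<zeta> = (\<Sum>k\<in>UNIV. \<tau> q k * z k)"
  have 1: "Z q k l = T q l * z k" for k l
  proof -
    have "(\<Sum>j\<in>UNIV. \<tau> q j * T q j) * Z q k l = (\<Sum>j\<in>UNIV. \<tau> q j * (T q j * Z q k l))"
      by (simp add: sum_distrib_right mult.assoc)
    also have "\<dots> = T q l * z k"
      unfolding T_Z[OF q, of _ k l] by (simp add: z_def sum_distrib_left mult_ac)
    finally show ?thesis by (simp add: \<tau>_T[OF q])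
  qed
  have sym: "T q l * z k = T q k * z l" for k l
    using 1[of k l] 1[of l k] Z_sym[OF q, of k l] by simp
  have "z l = T q l * \<zeta>" for l
  proof -
    have "T q l * \<zeta> = (\<Sum>k\<in>UNIV. \<tau> q k * (T q l * z k))"
      unfolding \<zeta>_def sum_distrib_left[of "T q l"] by (simp only: mult.left_commute)
    also have "\<dots> = (\<Sum>k\<in>UNIV. \<tau> q k * T q k) * z l"
      unfolding sum_distrib_right[of _ _ "z l"] by (simp only: sym[of l] mult.assoc)
    finally show ?thesis by (simp add: \<tau>_T[OF q])
  qed
  with 1 have 2: "Z q k l = \<zeta> * T q k * T q l" for k l by simp
  have "\<sigma> q = \<zeta> * (\<Sum>i\<in>UNIV. \<Sum>j\<in>UNIV. H q i j * (T q i * T q j))"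
    unfolding \<sigma>_def 2 by (simp add: sum_distrib_left mult_ac)
  with 2 show ?thesis by (simp add: T_unit[OF q])
qed

lemma Z_zero_iff:
  assumes q: "q \<in> W"
  shows "\<sigma> q = 0 \<longleftrightarrow> (\<forall>k l. Z q k l = 0)"
proof
  assume "\<sigma> q = 0"
  then show "\<forall>k l. Z q k l = 0" using Z_rank_one[OF q] by simp
next
  assume "\<forall>k l. Z q k l = 0"
  then show "\<sigma> q = 0" by (simp add: \<sigma>_def)
qed

text \<open>Trace of \<open>wzs\<close> after inserting \<open>Z_rank_one\<close>. The form of the
  right-hand side matters: \<open>\<sigma>\<close> times smooth coefficients, as
  \<open>linear_pde_zero_nbhd\<close> requires.\<close>

lemma D_\<sigma>:
  assumes q: "q \<in> W"
  shows "D k \<sigma> q = \<sigma> q * (A c q k + T q k * ((\<Sum>l\<in>UNIV. \<tau> q l * B c q l) + (\<Sum>l\<in>UNIV. \<tau> q l * D' c q l)))"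
proof -
  let ?tr = "\<lambda>f. \<Sum>i\<in>UNIV. \<Sum>j\<in>UNIV. H q i j * f i j"
  have "D k \<sigma> q = ?tr (nb2 (Z_tensor g \<phi>) q k)"
    unfolding \<sigma>_def[abs_def] using D_trace[of q "Z_tensor g \<phi>"] q Z_sm by simp
  also have "\<dots> = ?tr (\<lambda>i j. A c q k * Z q i j + \<sigma> q * T q k * (B c q i * T q j) + \<sigma> q * T q k * (D' c q j * T q i))"
    unfolding wzs[OF q] Z_rank_one[OF q, of k] by (simp add: mult_ac)
  also have "\<dots> = A c q k * \<sigma> q + \<sigma> q * T q k * ?tr (\<lambda>i j. B c q i * T q j) + \<sigma> q * T q k * ?tr (\<lambda>i j. D' c q j * T q i)"
    by (simp add: \<sigma>_def distrib_left sum.distrib sum_distrib_left mult.left_commute)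
  also have "?tr (\<lambda>i j. D' c q j * T q i) = ?tr (\<lambda>i j. D' c q i * T q j)"
    by (subst sum_swap_UNIV) (simp add: inv_metric_sym[OF q])
  finally show ?thesis unfolding trace_raise[OF q] by (simp add: algebra_simps)
qed

lemma \<sigma>_zero_nbhd:
  assumes "p \<in> W" "\<sigma> p = 0"
  shows "\<exists>V. open V \<and> p \<in> V \<and> V \<subseteq> W \<and> (\<forall>q\<in>V. \<sigma> q = 0)"
  by (rule linear_pde_zero_nbhd[OF \<sigma>_sm _ assms D_\<sigma>])
    (intro sm_add sm_mult sm_sum A_sm B_sm D_sm T_sm \<tau>_sm inv_metric_sm)

lemma \<sigma>_eq: "q \<in> W \<Longrightarrow> \<sigma> q = S q + real CARD('n) * \<phi> q"
  using metric_trace[of q]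
  by (simp add: \<sigma>_def Z_tensor_def scalar_curv_def distrib_left sum.distrib mult.left_commute
      sum_distrib_left[symmetric])

text \<open>Computes \<open>\<nabla>Z\<close> twice, by the product rule from
  \<open>Z_rank_one\<close> (\<open>Zd\<close>) and from the definition of \<open>Z\<close>
  (\<open>ZR\<close>), to obtain the hypotheses of \<open>parallel_algebra\<close>.\<close>

lemma normalized_parallel:
  assumes p: "p \<in> W" and n: "CARD('n) > 3" and \<sigma>p: "\<sigma> p \<noteq> 0"
    and harmonic: "\<And>j k l. div31 (conformal_curv g) p j k l = 0"
    and \<eta>_\<phi>: "\<And>j k. \<eta> c p j * D k \<phi> p - \<eta> c p k * D j \<phi> p = 0"
  shows "nabla_covector g (normalized_covector g \<eta>) c p k l = 0"
proof -
  let ?n = "real CARD('n)"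
  let ?dT = "nabla_covector g (normalized_covector g \<eta>) c p"
  let ?w = "\<lambda>k. 1 / (2 * (?n - 1)) * ((?n - 2) * D k \<phi> p + D k \<sigma> p)"
  have Zd: "nb2 (Z_tensor g \<phi>) p k j l = D k \<sigma> p * T p j * T p l + \<sigma> p * (?dT k j * T p l + T p j * ?dT k l)" for k j l
  proof -
    have "D k (\<lambda>q. Z q j l) p = D k (\<lambda>q. \<sigma> q * T q j * T q l) p"
      by (rule D_cong[OF _ p]) (rule Z_rank_one)
    also have "\<dots> = D k \<sigma> p * T p j * T p l + \<sigma> p * D k (\<lambda>q. T q j) p * T p l + \<sigma> p * T p j * D k (\<lambda>q. T q l) p"
      using p by (simp add: D_mult sm_mult \<sigma>_sm T_sm algebra_simps)
    finally show ?thesis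
      by (simp add: nabla_tensor02_def nabla_covector_def Z_rank_one[OF p] sum_distrib_left algebra_simps)
  qed
  have DS: "D k S p = D k \<sigma> p - ?n * D k \<phi> p" for k
  proof -
    have "D k \<sigma> p = D k (\<lambda>q. S q + ?n * \<phi> q) p"
      by (rule D_cong[OF _ p]) (rule \<sigma>_eq)
    then show ?thesis using p by (simp add: D_add D_cmult sm_mult \<phi>_sm scalar_curv_sm)
  qed
  have ZR: "nb2 (Z_tensor g \<phi>) p k j l = nb2 (ricci g) p k j l + D k \<phi> p * G p j l" for k j l
  proof -
    have "nb2 (Z_tensor g \<phi>) p k j l = nb2 (ricci g) p k j l + nb2 (\<lambda>c q k l. (\<lambda>c. \<phi>) c q * g c q k l) p k j l"
      using p by (simp add: nabla_tensor02_def Z_tensor_def D_add sm_mult \<phi>_sm field_sm distrib_left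
          sum.distrib)
    then show ?thesis using nabla_scalar_metric[OF p, of "\<lambda>c. \<phi>"] \<phi>_sm by simp
  qed
  show ?thesis
  proof (rule parallel_algebra[where dT = ?dT and T = "T p" and \<tau> = "\<tau> p" and G = "G p" and H = "H p"
        and A = "A c p" and B = "B c p" and D = "D' c p" and d\<phi> = "\<lambda>k. D k \<phi> p" and d\<sigma> = "\<lambda>k. D k \<sigma> p"
        and w = ?w and \<sigma> = "\<sigma> p" and n = ?n and b = "1 / (2 * (?n - 1))"])
    show "(\<Sum>l\<in>UNIV. \<tau> p l * ?dT k l) = 0" for k
      by (rule nabla_unit_covector[OF p]) (use T_sm T_unit in auto)
    show "D k \<sigma> p * T p j * T p l + \<sigma> p * (?dT k j * T p l + T p j * ?dT k l)
      = A c p k * (\<sigma> p * T p j * T p l) + B c p j * (\<sigma> p * T p k * T p l) + D' c p l * (\<sigma> p * T p k * T p j)" for k j l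
      unfolding Zd[symmetric] wzs[OF p] Z_rank_one[OF p] ..
    show "(D k \<sigma> p * T p j * T p l + \<sigma> p * (?dT k j * T p l + T p j * ?dT k l))
      - (D j \<sigma> p * T p k * T p l + \<sigma> p * (?dT j k * T p l + T p k * ?dT j l)) = ?w k * G p j l - ?w j * G p k l" for k j l
    proof -
      have "nb2 (ricci g) p k j l - nb2 (ricci g) p j k l = (D k S p * G p j l - D j S p * G p k l) / (2 * (?n - 1))"
        by (rule codazzi_ricci[OF p n harmonic])
      then show ?thesis
        unfolding Zd[symmetric] ZR DS using n by (intro wzs_codazzi_arith) auto
    qed
    show "T p j * D k \<phi> p = T p k * D j \<phi> p" for j k
      using \<eta>_\<phi>[of j k] by (simp add: normalized_covector_def)
    show "(\<Sum>l\<in>UNIV. \<tau> p l * T p l) = 1" by (rule \<tau>_T[OF p])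
    show "(\<Sum>l\<in>UNIV. \<tau> p l * G p j l) = T p j" for j by (rule lower_raise[OF p])
    show "(\<Sum>j\<in>UNIV. \<Sum>l\<in>UNIV. H p j l * (x j * T p l)) = (\<Sum>l\<in>UNIV. \<tau> p l * x l)" for x
      by (rule trace_raise[OF p])
    show "(\<Sum>j\<in>UNIV. \<Sum>l\<in>UNIV. H p j l * G p j l) = ?n" by (rule metric_trace[OF p])
    show "(\<Sum>j\<in>UNIV. \<Sum>l\<in>UNIV. H p j l * (x j * G p k l)) = x k" for x k
      by (rule trace_covector_metric[OF p])
    show "1 / (2 * (?n - 1)) \<noteq> 0" "?n > 2" using n by simp_all
    show "\<sigma> p \<noteq> 0" by (rule \<sigma>p)
  qed (rule refl)
qed

end

section \<open>Change of charts\<close>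

locale chart_overlap = c: chart_region c W + d: chart_region d W
  for c d :: "('a::topological_space, 'n::finite) chart" and W :: "'a set" +
  assumes y_sm: "smooth_in_chart c W (\<lambda>q. coords d q $ a)"
    and x_sm: "smooth_in_chart d W (\<lambda>q. coords c q $ a)"
begin

text \<open>The Jacobian of the transition map: \<open>a\<close> belongs to chart \<open>d\<close>,
  \<open>k\<close> to chart \<open>c\<close>.\<close>

definition J :: "'n \<Rightarrow> 'n \<Rightarrow> 'a \<Rightarrow> real" where
  "J a k = coord_deriv c k (\<lambda>q. coords d q $ a)"

lemma J_sm: "c.sm (J a k)"
  unfolding J_def by (rule c.sm_D[OF y_sm])

lemma chain: "d.sm f \<Longrightarrow> p \<in> W \<Longrightarrow> c.D k f p = (\<Sum>a\<in>UNIV. J a k p * d.D a f p)"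
  unfolding J_def
  by (rule coord_deriv_chain(2)[OF c.chart_region_axioms d.chart_region_axioms _ y_sm])

text \<open>By the chain rule the derivatives in \<open>c\<close> are sums of products of
  \<open>J\<close>, smooth in \<open>c\<close>, with derivatives of \<open>f\<close> in
  \<open>d\<close>; the latter are again smooth in \<open>d\<close>, so the induction hypothesis
  applies to them.\<close>

lemma Ck_transfer: "d.sm f \<Longrightarrow> Ck_on k (coords c ` W) (\<lambda>u. f (chart_inv c u))"
proof (induction k arbitrary: f)
  have diff: "(\<lambda>u. f (chart_inv c u)) differentiable (at u)" if "d.sm f" "u \<in> coords c ` W" for f u
    using that coord_deriv_chain(1)[OF c.chart_region_axioms d.chart_region_axioms _ y_sm] by auto
  case 0
  then have "(\<lambda>u. f (chart_inv c u)) differentiable_on (coords c ` W)"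
    using diff by (auto simp: differentiable_on_def intro: differentiable_at_withinI)
  then show ?case using differentiable_imp_continuous_on by auto
next
  have diff: "(\<lambda>u. f (chart_inv c u)) differentiable (at u)" if "d.sm f" "u \<in> coords c ` W" for f u
    using that coord_deriv_chain(1)[OF c.chart_region_axioms d.chart_region_axioms _ y_sm] by auto
  case (Suc k)
  have "Ck_on k (coords c ` W) (partial_deriv i (\<lambda>u. f (chart_inv c u)))" for i
  proof -
    have fin: "Ck_on k (coords c ` W) (\<lambda>u. \<Sum>a\<in>A. J a i (chart_inv c u) * d.D a f (chart_inv c u))"
      if "finite A" for A
      using that
    proof induction
      case (insert a A)
      have "Ck_on k (coords c ` W) (\<lambda>u. J a i (chart_inv c u) * d.D a f (chart_inv c u))"
        by (intro Ck_on_mult[OF c.open_coords_image] c.sm_Ck[OF J_sm] Suc.IH d.sm_D Suc.prems)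
      with insert show ?case by (simp add: Ck_on_add[OF c.open_coords_image])
    qed (simp add: Ck_on_const)
    have eq: "partial_deriv i (\<lambda>u. f (chart_inv c u)) u
        = (\<Sum>a\<in>UNIV. J a i (chart_inv c u) * d.D a f (chart_inv c u))" if "u \<in> coords c ` W" for u
      using that chain[OF Suc.prems, of "chart_inv c u" i] c.chart_inv_image[OF that]
        c.chart_inv_coords c.W_sub by (auto simp: coord_deriv_def o_def)
    show ?thesis using fin[of UNIV] Ck_on_cong[OF c.open_coords_image eq] by simp
  qed
  with Suc.prems diff show ?case by simp
qed

lemma sm_transfer: "d.sm f \<Longrightarrow> c.sm f"
  by (rule c.smI) (rule Ck_transfer)

lemma D_coords: "p \<in> W \<Longrightarrow> c.D k (\<lambda>q. coords c q $ m) p = (if k = m then 1 else 0)"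
proof -
  assume p: "p \<in> W"
  have "((\<lambda>u::real^'n. u $ m) has_derivative (\<lambda>v. v $ m)) (at u)" for u
    by (rule bounded_linear_imp_has_derivative) (rule bounded_linear_vec_nth)
  from partial_deriv_eq[OF this] have "partial_deriv k (\<lambda>u. u $ m) (coords c p) = (if k = m then 1 else 0)"
    by (auto simp: axis_def)
  moreover have "partial_deriv k (\<lambda>u. coords c (chart_inv c u) $ m) (coords c p) = partial_deriv k (\<lambda>u. u $ m) (coords c p)"
    by (rule partial_deriv_cong[OF c.open_coords_image]) (use p c.W_sub c.chart_inv_coords in auto)
  ultimately show ?thesis by (simp add: coord_deriv_def o_def)
qed

lemma J_inverse:
  "p \<in> W \<Longrightarrow> (\<Sum>a\<in>UNIV. J a k p * d.D a (\<lambda>q. coords c q $ m) p) = (if k = m then 1 else 0)"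
  using chain[OF x_sm] D_coords by simp

lemma D_J_sym: "p \<in> W \<Longrightarrow> c.D k (J a l) p = c.D l (J a k) p"
  unfolding J_def by (rule c.D_commute[OF y_sm])

end

text \<open>Adds the overlap with exchanged charts, whose Jacobian \<open>K\<close> is the inverse
  of \<open>J\<close>.\<close>

locale chart_overlap_inverse = chart_overlap c d W for c d :: "('a::topological_space, 'n::finite) chart" and W
begin

sublocale rev: chart_overlap d c W
  by unfold_locales (rule x_sm, rule y_sm)

definition K :: "'n \<Rightarrow> 'n \<Rightarrow> 'a \<Rightarrow> real" where
  "K m a = d.D a (\<lambda>q. coords c q $ m)"

lemma J_K: "p \<in> W \<Longrightarrow> (\<Sum>a\<in>UNIV. J a k p * K m a p) = (if k = m then 1 else 0)"
  unfolding K_def by (rule J_inverse)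

lemma K_J: "p \<in> W \<Longrightarrow> (\<Sum>m\<in>UNIV. K m a p * J b m p) = (if a = b then 1 else 0)"
  using rev.J_inverse[of p a b] by (simp add: rev.J_def K_def J_def)

lemma J_inj:
  assumes p: "p \<in> W" and v: "\<And>m. (\<Sum>b\<in>UNIV. v b * J b m p) = 0"
  shows "v a = 0"
proof -
  have "v a = (\<Sum>b\<in>UNIV. v b * (\<Sum>m\<in>UNIV. J b m p * K m a p))"
    using K_J[OF p, of a] by (simp add: mult.commute)
  also have "\<dots> = 0" unfolding sum_sum_assoc[symmetric] by (simp add: v)
  finally show ?thesis .
qed

end

section \<open>Transformation laws of connection and curvature\<close>

locale riemannian_overlap = chart_overlap_inverse c d W + rc: riemannian_region c W g + rd: riemannian_region d W g
  for c d :: "('a::topological_space, 'n::finite) chart" and W :: "'a set" and g :: "('a, 'n) tensor02" +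
  assumes g_law: "p \<in> W \<Longrightarrow> g c p j l = (\<Sum>a\<in>UNIV. \<Sum>b\<in>UNIV. J a j p * J b l p * g d p a b)"
begin

text \<open>The connection matrix of chart \<open>d\<close> with its form index pulled back to
  \<open>c\<close>; \<open>f\<close> and \<open>a\<close> remain indices of
  \<open>d\<close>.\<close>

definition \<Omega> :: "'n \<Rightarrow> 'n \<Rightarrow> 'n \<Rightarrow> 'a \<Rightarrow> real" where
  "\<Omega> k f a q = (\<Sum>e\<in>UNIV. J e k q * rd.\<Gamma> q a e f)"

text \<open>The inhomogeneous right-hand side of the transformation law for Christoffel symbols,
  which \<open>christoffel_law\<close> establishes.\<close>

definition P :: "'n \<Rightarrow> 'n \<Rightarrow> 'n \<Rightarrow> 'a \<Rightarrow> real" where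
  "P a k l q = c.D k (J a l) q + (\<Sum>f\<in>UNIV. J f l q * \<Omega> k f a q)"

lemma \<Omega>_sm: "c.sm (\<Omega> k f a)"
  unfolding \<Omega>_def[abs_def] by (intro c.sm_sum c.sm_mult J_sm sm_transfer rd.christoffel_sm)

lemma P_sym:
  assumes p: "p \<in> W"
  shows "P a k l p = P a l k p"
proof -
  have "(\<Sum>f\<in>UNIV. J f l p * \<Omega> k f a p) = (\<Sum>f\<in>UNIV. \<Sum>e\<in>UNIV. J f l p * (J e k p * rd.\<Gamma> p a e f))" for k l
    by (simp add: \<Omega>_def sum_distrib_left)
  moreover have "(\<Sum>f\<in>UNIV. \<Sum>e\<in>UNIV. J f l p * (J e k p * rd.\<Gamma> p a e f))
      = (\<Sum>f\<in>UNIV. \<Sum>e\<in>UNIV. J f k p * (J e l p * rd.\<Gamma> p a e f))"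
    by (subst sum_swap_UNIV, intro sum.cong refl)
      (simp add: rd.christoffel_sym[OF p, of a] mult.left_commute)
  ultimately show ?thesis using D_J_sym[OF p, of k a l] by (simp add: P_def)
qed

text \<open>Derivative of \<open>g_law\<close>. The derivatives of \<open>J\<close> combine with the
  Christoffel symbols of \<open>d\<close> to \<open>P\<close>, which gives the analogue of
  \<open>D_metric\<close> for the connection carried over from \<open>d\<close>.\<close>

lemma D_metric_pair:
  assumes p: "p \<in> W"
  defines "Q \<equiv> \<lambda>k l m. \<Sum>a\<in>UNIV. \<Sum>b\<in>UNIV. P a k l p * J b m p * rd.G p a b"
  shows "c.D k (\<lambda>q. rc.G q l m) p = Q k l m + Q k m l"
proof -
  let ?\<Gamma> = "rd.\<Gamma> p" and ?J = "\<lambda>a k. J a k p" and ?G = "rd.G p"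
  have DG: "c.D k (\<lambda>q. rd.G q a b) p = (\<Sum>s\<in>UNIV. \<Omega> k a s p * ?G s b) + (\<Sum>s\<in>UNIV. \<Omega> k b s p * ?G a s)" for a b
    unfolding chain[OF rd.g_sm p] rd.D_metric[OF p] distrib_left sum.distrib \<Omega>_def sum_sum_assoc ..
  have "c.D k (\<lambda>q. rc.G q l m) p = c.D k (\<lambda>q. \<Sum>a\<in>UNIV. \<Sum>b\<in>UNIV. J a l q * J b m q * rd.G q a b) p"
    by (rule c.D_cong[OF _ p]) (rule g_law)
  also have "\<dots> = (\<Sum>a\<in>UNIV. \<Sum>b\<in>UNIV. ?J a l * ?J b m * c.D k (\<lambda>q. rd.G q a b) p
      + (?J a l * c.D k (J b m) p + c.D k (J a l) p * ?J b m) * ?G a b)"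
    using p by (simp add: c.D_sum c.D_mult c.sm_sum c.sm_mult J_sm sm_transfer rd.g_sm)
  also have "\<dots> = (\<Sum>a\<in>UNIV. \<Sum>b\<in>UNIV. \<Sum>s\<in>UNIV. ?J a l * ?J b m * (\<Omega> k a s p * ?G s b))
      + (\<Sum>a\<in>UNIV. \<Sum>b\<in>UNIV. \<Sum>s\<in>UNIV. ?J a l * ?J b m * (\<Omega> k b s p * ?G a s))
      + (\<Sum>a\<in>UNIV. \<Sum>b\<in>UNIV. ?J a l * c.D k (J b m) p * ?G a b)
      + (\<Sum>a\<in>UNIV. \<Sum>b\<in>UNIV. c.D k (J a l) p * ?J b m * ?G a b)"
    unfolding DG by (simp add: distrib_left distrib_right sum.distrib sum_distrib_left)
  also have "(\<Sum>a\<in>UNIV. \<Sum>b\<in>UNIV. \<Sum>s\<in>UNIV. ?J a l * ?J b m * (\<Omega> k a s p * ?G s b))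
      = (\<Sum>a\<in>UNIV. \<Sum>b\<in>UNIV. \<Sum>s\<in>UNIV. ?J s l * ?J b m * (\<Omega> k s a p * ?G a b))"
    by (rule sum3_swap13)
  also have "(\<Sum>a\<in>UNIV. \<Sum>b\<in>UNIV. \<Sum>s\<in>UNIV. ?J a l * ?J b m * (\<Omega> k b s p * ?G a s))
      = (\<Sum>a\<in>UNIV. \<Sum>b\<in>UNIV. \<Sum>s\<in>UNIV. ?J a l * ?J s m * (\<Omega> k s b p * ?G a b))"
    by (rule sum3_swap23)
  finally have "c.D k (\<lambda>q. rc.G q l m) p = Q k l m + (\<Sum>a\<in>UNIV. \<Sum>b\<in>UNIV. ?J a l * P b k m p * ?G a b)"
    by (simp add: Q_def P_def distrib_left distrib_right sum.distrib sum_distrib_left sum_distrib_right mult_ac)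
  also have "(\<Sum>a\<in>UNIV. \<Sum>b\<in>UNIV. ?J a l * P b k m p * ?G a b) = Q k m l"
    unfolding Q_def by (subst sum_swap_UNIV) (simp add: rd.g_sym[OF p] mult_ac)
  finally show ?thesis .
qed

text \<open>Uniqueness of the Levi-Civita connection: \<open>P\<close> is symmetric and compatible
  with the metric, so \<open>christoffel_lower\<close> yields the same lowered symbols.
  Nondegeneracy of \<open>J\<close> and of the metric then removes the contraction.\<close>

lemma christoffel_law:
  assumes p: "p \<in> W"
  shows "(\<Sum>s\<in>UNIV. rc.\<Gamma> p s k l * J a s p) = P a k l p"
proof -
  let ?Q = "\<lambda>k l m. \<Sum>a\<in>UNIV. \<Sum>b\<in>UNIV. P a k l p * J b m p * rd.G p a b"
  define R where "R = (\<lambda>a. (\<Sum>s\<in>UNIV. rc.\<Gamma> p s k l * J a s p) - P a k l p)"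
  have "(\<Sum>b\<in>UNIV. (\<Sum>a\<in>UNIV. R a * rd.G p a b) * J b m p) = 0" for m
  proof -
    have "(\<Sum>s\<in>UNIV. rc.\<Gamma> p s k l * rc.G p s m) = ?Q k l m"
      unfolding rc.christoffel_lower[OF p] D_metric_pair[OF p]
      by (simp add: P_sym[OF p, of _ l k] P_sym[OF p, of _ m])
    moreover have "(\<Sum>s\<in>UNIV. rc.\<Gamma> p s k l * rc.G p s m)
        = (\<Sum>a\<in>UNIV. \<Sum>b\<in>UNIV. (\<Sum>s\<in>UNIV. rc.\<Gamma> p s k l * J a s p) * J b m p * rd.G p a b)"
    proof -
      have "(\<Sum>s\<in>UNIV. rc.\<Gamma> p s k l * rc.G p s m)
        = (\<Sum>s\<in>UNIV. \<Sum>a\<in>UNIV. \<Sum>b\<in>UNIV. rc.\<Gamma> p s k l * (J a s p * J b m p * rd.G p a b))"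
        by (simp add: g_law[OF p] sum_distrib_left)
      also have "\<dots> = (\<Sum>s\<in>UNIV. \<Sum>b\<in>UNIV. \<Sum>a\<in>UNIV. rc.\<Gamma> p s k l * (J a s p * J b m p * rd.G p a b))"
        by (rule sum3_swap23)
      also have "\<dots> = (\<Sum>a\<in>UNIV. \<Sum>b\<in>UNIV. \<Sum>s\<in>UNIV. rc.\<Gamma> p s k l * (J a s p * J b m p * rd.G p a b))"
        by (rule sum3_swap13)
      finally show ?thesis by (simp add: sum_distrib_left sum_distrib_right mult_ac)
    qed
    ultimately have "(\<Sum>a\<in>UNIV. \<Sum>b\<in>UNIV. R a * J b m p * rd.G p a b) = 0"
      by (simp add: R_def left_diff_distrib sum_subtractf)
    then show ?thesis
      by (subst (asm) sum_swap_UNIV) (simp add: sum_distrib_left sum_distrib_right mult_ac)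
  qed
  then have *: "(\<Sum>a\<in>UNIV. R a * rd.G p a b) = 0" for b by (rule J_inj[OF p])
  have "R a = (\<Sum>b\<in>UNIV. R b * (\<Sum>s\<in>UNIV. rd.G p b s * rd.H p s a))"
    by (simp add: rd.metric_inv[OF p])
  also have "\<dots> = 0" unfolding sum_sum_assoc[symmetric] by (simp add: *)
  finally show ?thesis by (simp add: R_def)
qed

text \<open>The curvature of the pulled back connection is the pull-back of the curvature; the
  second derivatives of the coordinates drop out because they commute.\<close>

lemma curvature_pullback:
  assumes p: "p \<in> W"
  shows "c.D k (\<Omega> j f a) p - c.D j (\<Omega> k f a) p
      + ((\<Sum>e\<in>UNIV. \<Omega> j f e p * \<Omega> k e a p) - (\<Sum>e\<in>UNIV. \<Omega> k f e p * \<Omega> j e a p))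
    = (\<Sum>b\<in>UNIV. \<Sum>h\<in>UNIV. J b j p * J h k p * riemann g d p b h f a)"
proof -
  let ?J = "\<lambda>a k. J a k p" and ?\<Gamma> = "rd.\<Gamma> p" and ?d = "\<lambda>h a b f. d.D h (\<lambda>q. rd.\<Gamma> q a b f) p"
  have D: "c.D k (\<Omega> j f a) p = (\<Sum>b\<in>UNIV. \<Sum>h\<in>UNIV. ?J b j * ?J h k * ?d h a b f)
      + (\<Sum>b\<in>UNIV. c.D k (J b j) p * ?\<Gamma> a b f)" for k j
  proof -
    have "c.D k (\<Omega> j f a) p = (\<Sum>b\<in>UNIV. ?J b j * c.D k (\<lambda>q. rd.\<Gamma> q a b f) p + c.D k (J b j) p * ?\<Gamma> a b f)"
      unfolding \<Omega>_def[abs_def] using p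
      by (simp add: c.D_sum c.D_mult c.sm_sum c.sm_mult J_sm sm_transfer rd.christoffel_sm)
    then show ?thesis
      by (simp add: chain[OF rd.christoffel_sm p] sum.distrib sum_distrib_left mult.assoc)
  qed
  have O: "(\<Sum>e\<in>UNIV. \<Omega> j f e p * \<Omega> k e a p)
      = (\<Sum>b\<in>UNIV. \<Sum>h\<in>UNIV. ?J b j * ?J h k * (\<Sum>e\<in>UNIV. ?\<Gamma> e b f * ?\<Gamma> a h e))" for j k
  proof -
    have "(\<Sum>e\<in>UNIV. \<Omega> j f e p * \<Omega> k e a p)
      = (\<Sum>e\<in>UNIV. \<Sum>b\<in>UNIV. \<Sum>h\<in>UNIV. ?J b j * ?J h k * (?\<Gamma> e b f * ?\<Gamma> a h e))"
      by (simp add: \<Omega>_def sum_product mult_ac)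
    also have "\<dots> = (\<Sum>e\<in>UNIV. \<Sum>h\<in>UNIV. \<Sum>b\<in>UNIV. ?J b j * ?J h k * (?\<Gamma> e b f * ?\<Gamma> a h e))"
      by (rule sum3_swap23)
    also have "\<dots> = (\<Sum>b\<in>UNIV. \<Sum>h\<in>UNIV. \<Sum>e\<in>UNIV. ?J b j * ?J h k * (?\<Gamma> e b f * ?\<Gamma> a h e))"
      by (rule sum3_swap13)
    finally show ?thesis by (simp add: sum_distrib_left)
  qed
  have "(\<Sum>b\<in>UNIV. \<Sum>h\<in>UNIV. ?J b k * ?J h j * ?d h a b f) = (\<Sum>b\<in>UNIV. \<Sum>h\<in>UNIV. ?J b j * ?J h k * ?d b a h f)"
    by (subst sum_swap_UNIV) (simp add: mult_ac)
  moreover have "(\<Sum>b\<in>UNIV. \<Sum>h\<in>UNIV. ?J b k * ?J h j * (\<Sum>e\<in>UNIV. ?\<Gamma> e b f * ?\<Gamma> a h e))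
      = (\<Sum>b\<in>UNIV. \<Sum>h\<in>UNIV. ?J b j * ?J h k * (\<Sum>e\<in>UNIV. ?\<Gamma> e h f * ?\<Gamma> a b e))"
    by (subst sum_swap_UNIV) (simp add: mult_ac)
  ultimately show ?thesis
    unfolding D O by (simp add: D_J_sym[OF p, of k _ j] riemann_def distrib_left right_diff_distrib
        sum.distrib sum_subtractf)
qed

text \<open>Matrix notation: with \<open>(\<omega>\<^sub>k)\<^sub>l\<^sup>s = \<Gamma>\<^sup>s\<^sub>k\<^sub>l\<close> the transformation law of the Christoffel symbols is the
  gauge transformation \<open>\<omega>\<^sub>k J = \<partial>\<^sub>k J + J \<Omega>\<^sub>k\<close>; antisymmetrizing its derivative shows that the curvature
  of \<open>\<omega>\<close> is conjugate by \<open>J\<close> to that of \<open>\<Omega>\<close>.\<close>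
lemma riemann_law:
  assumes p: "p \<in> W"
  shows "(\<Sum>t\<in>UNIV. riemann g c p j k l t * J a t p)
    = (\<Sum>f\<in>UNIV. J f l p * (\<Sum>b\<in>UNIV. \<Sum>h\<in>UNIV. J b j p * J h k p * riemann g d p b h f a))"
proof -
  let ?J = "\<lambda>a k. J a k p" and ?\<Gamma> = "rc.\<Gamma> p" and ?\<Omega> = "\<lambda>k f a. \<Omega> k f a p"
  let ?d\<Gamma> = "\<lambda>j s k l. c.D j (\<lambda>q. rc.\<Gamma> q s k l) p" and ?d\<Omega> = "\<lambda>j k e a. c.D j (\<Omega> k e a) p"
  have dJ: "c.D j (J a s) p = (\<Sum>t\<in>UNIV. ?\<Gamma> t j s * ?J a t) - (\<Sum>e\<in>UNIV. ?J e s * ?\<Omega> j e a)" for j a s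
    using christoffel_law[OF p, of j s a] by (simp add: P_def)
  \<comment> \<open>Writing \<omega> for the connection of \<open>c\<close>, these are the products
    \<open>\<omega> J \<Omega>\<close> and \<open>J \<Omega> \<Omega>\<close>. \<open>X\<close>
    enters \<open>eq\<close> only through the symmetric \<open>X j k + X k j\<close> and disappears
    in the antisymmetrization.\<close>
  define X where "X = (\<lambda>j k. \<Sum>e\<in>UNIV. (\<Sum>t\<in>UNIV. ?\<Gamma> t j l * ?J e t) * ?\<Omega> k e a)"
  define Y where "Y = (\<lambda>j k. \<Sum>f\<in>UNIV. ?J f l * (\<Sum>e\<in>UNIV. ?\<Omega> j f e * ?\<Omega> k e a))"
  have eq: "(\<Sum>s\<in>UNIV. ?d\<Gamma> j s k l * ?J a s) + (\<Sum>t\<in>UNIV. (\<Sum>s\<in>UNIV. ?\<Gamma> s k l * ?\<Gamma> t j s) * ?J a t) - X k j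
      = c.D j (c.D k (J a l)) p + X j k - Y j k + (\<Sum>f\<in>UNIV. ?J f l * ?d\<Omega> j k f a)" for j k
  proof -
    have "c.D j (\<lambda>q. \<Sum>s\<in>UNIV. rc.\<Gamma> q s k l * J a s q) p
        = c.D j (\<lambda>q. c.D k (J a l) q + (\<Sum>f\<in>UNIV. J f l q * \<Omega> k f a q)) p"
      by (rule c.D_cong[OF _ p]) (simp add: christoffel_law P_def)
    then have "(\<Sum>s\<in>UNIV. ?\<Gamma> s k l * c.D j (J a s) p) + (\<Sum>s\<in>UNIV. ?d\<Gamma> j s k l * ?J a s)
        = c.D j (c.D k (J a l)) p + ((\<Sum>f\<in>UNIV. ?J f l * ?d\<Omega> j k f a) + (\<Sum>f\<in>UNIV. c.D j (J f l) p * ?\<Omega> k f a))"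
      using p by (simp add: c.D_add c.D_sum c.D_mult c.sm_sum c.sm_mult c.sm_D J_sm \<Omega>_sm rc.christoffel_sm sum.distrib)
    moreover have "(\<Sum>s\<in>UNIV. ?\<Gamma> s k l * c.D j (J a s) p)
        = (\<Sum>t\<in>UNIV. (\<Sum>s\<in>UNIV. ?\<Gamma> s k l * ?\<Gamma> t j s) * ?J a t) - X k j"
      unfolding dJ X_def sum_sum_assoc by (simp add: right_diff_distrib sum_subtractf)
    moreover have "(\<Sum>f\<in>UNIV. c.D j (J f l) p * ?\<Omega> k f a) = X j k - Y j k"
      unfolding dJ X_def Y_def sum_sum_assoc[symmetric] by (simp add: left_diff_distrib sum_subtractf)
    ultimately show ?thesis by linarith
  qed
  have "(\<Sum>t\<in>UNIV. riemann g c p j k l t * J a t p)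
      = ((\<Sum>s\<in>UNIV. ?d\<Gamma> k s j l * ?J a s) + (\<Sum>t\<in>UNIV. (\<Sum>s\<in>UNIV. ?\<Gamma> s j l * ?\<Gamma> t k s) * ?J a t))
      - ((\<Sum>s\<in>UNIV. ?d\<Gamma> j s k l * ?J a s) + (\<Sum>t\<in>UNIV. (\<Sum>s\<in>UNIV. ?\<Gamma> s k l * ?\<Gamma> t j s) * ?J a t))"
    by (simp add: riemann_def left_diff_distrib distrib_right sum.distrib sum_subtractf)
  also have "\<dots> = Y j k - Y k j + (\<Sum>f\<in>UNIV. ?J f l * ?d\<Omega> k j f a) - (\<Sum>f\<in>UNIV. ?J f l * ?d\<Omega> j k f a)"
    using eq[of j k] eq[of k j] c.D_commute[OF J_sm p, of j k a l] by linarith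
  also have "\<dots> = (\<Sum>f\<in>UNIV. ?J f l * (?d\<Omega> k j f a - ?d\<Omega> j k f a
      + ((\<Sum>e\<in>UNIV. ?\<Omega> j f e * ?\<Omega> k e a) - (\<Sum>e\<in>UNIV. ?\<Omega> k f e * ?\<Omega> j e a))))"
    by (simp add: Y_def distrib_left right_diff_distrib sum.distrib sum_subtractf)
  finally show ?thesis unfolding curvature_pullback[OF p] .
qed

lemma ricci_law:
  assumes p: "p \<in> W"
  shows "ricci g c p k l = (\<Sum>h\<in>UNIV. \<Sum>f\<in>UNIV. J h k p * J f l p * ricci g d p h f)"
proof -
  define U where "U = (\<lambda>b a. \<Sum>f\<in>UNIV. \<Sum>h\<in>UNIV. J f l p * J h k p * riemann g d p b h f a)"
  have U: "(\<Sum>t\<in>UNIV. riemann g c p j k l t * J a t p) = (\<Sum>b\<in>UNIV. J b j p * U b a)" for j a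
  proof -
    have "(\<Sum>t\<in>UNIV. riemann g c p j k l t * J a t p)
      = (\<Sum>f\<in>UNIV. \<Sum>b\<in>UNIV. \<Sum>h\<in>UNIV. J f l p * (J b j p * J h k p * riemann g d p b h f a))"
      unfolding riemann_law[OF p] by (simp add: sum_distrib_left)
    also have "\<dots> = (\<Sum>b\<in>UNIV. \<Sum>f\<in>UNIV. \<Sum>h\<in>UNIV. J f l p * (J b j p * J h k p * riemann g d p b h f a))"
      by (rule sum.swap)
    finally show ?thesis by (simp add: U_def sum_distrib_left mult_ac)
  qed
  \<comment> \<open>A Kronecker delta written as \<open>J K\<close> produces the contraction with
    \<open>J\<close> to which \<open>U\<close> applies; afterwards \<open>K\<close> meets the other
    \<open>J\<close> and cancels.\<close>
  have "(\<Sum>j\<in>UNIV. riemann g c p j k l j) = (\<Sum>j\<in>UNIV. \<Sum>t\<in>UNIV. riemann g c p j k l t * (\<Sum>a\<in>UNIV. J a t p * K j a p))"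
    by (simp add: J_K[OF p])
  also have "\<dots> = (\<Sum>j\<in>UNIV. \<Sum>a\<in>UNIV. \<Sum>b\<in>UNIV. J b j p * U b a * K j a p)"
    unfolding sum_sum_assoc[symmetric] U by (simp add: sum_distrib_right)
  also have "\<dots> = (\<Sum>j\<in>UNIV. \<Sum>b\<in>UNIV. \<Sum>a\<in>UNIV. J b j p * U b a * K j a p)"
    by (rule sum3_swap23)
  also have "\<dots> = (\<Sum>a\<in>UNIV. \<Sum>b\<in>UNIV. \<Sum>j\<in>UNIV. J b j p * U b a * K j a p)"
    by (rule sum3_swap13)
  also have "\<dots> = (\<Sum>a\<in>UNIV. \<Sum>b\<in>UNIV. U b a * (\<Sum>j\<in>UNIV. K j a p * J b j p))"
    by (simp add: sum_distrib_left mult_ac)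
  also have "\<dots> = (\<Sum>a\<in>UNIV. U a a)" by (simp add: K_J[OF p])
  also have "\<dots> = (\<Sum>h\<in>UNIV. \<Sum>f\<in>UNIV. \<Sum>a\<in>UNIV. J f l p * J h k p * riemann g d p a h f a)"
    unfolding U_def by (rule sum3_swap13[of "\<lambda>a f h. J f l p * J h k p * riemann g d p a h f a"])
  finally show ?thesis by (simp add: ricci_def sum_negf sum_distrib_left mult_ac)
qed

lemma Z_law:
  assumes p: "p \<in> W"
  shows "Z_tensor g \<phi> c p k l = (\<Sum>h\<in>UNIV. \<Sum>f\<in>UNIV. J h k p * J f l p * Z_tensor g \<phi> d p h f)"
  by (simp add: Z_tensor_def ricci_law[OF p] g_law[OF p] distrib_left sum.distrib sum_distrib_left mult_ac)

text \<open>Raised vectors are pushed forward by the Jacobian: \<open>v\<close> solves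
  \<open>G v = y\<close> in chart \<open>d\<close>, hence is \<open>y\<close> raised there, and both
  sides become pairings of a vector with a covector. It makes the norm of \<eta> independent of the
  chart.\<close>

lemma norm_square_law:
  assumes p: "p \<in> W" and x: "\<And>i. x i = (\<Sum>a\<in>UNIV. J a i p * y a)"
  shows "(\<Sum>i\<in>UNIV. \<Sum>j\<in>UNIV. rc.H p i j * x i * x j) = (\<Sum>a\<in>UNIV. \<Sum>b\<in>UNIV. rd.H p a b * y a * y b)"
proof -
  define r where "r = rc.raise x p"
  define v where "v = (\<lambda>b. \<Sum>i\<in>UNIV. J b i p * r i)"
  have "(\<Sum>a\<in>UNIV. ((\<Sum>b\<in>UNIV. rd.G p a b * v b) - y a) * J a m p) = 0" for m
  proof -
    have "(\<Sum>i\<in>UNIV. r i * rc.G p m i) = x m"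
      unfolding r_def by (rule rc.lower_raise[OF p])
    then have "(\<Sum>i\<in>UNIV. rc.G p m i * r i) = x m"
      by (simp only: mult.commute)
    moreover have "(\<Sum>i\<in>UNIV. rc.G p m i * r i)
        = (\<Sum>i\<in>UNIV. \<Sum>a\<in>UNIV. \<Sum>b\<in>UNIV. J a m p * J b i p * rd.G p a b * r i)"
      by (simp add: g_law[OF p] sum_distrib_right)
    moreover have "\<dots> = (\<Sum>i\<in>UNIV. \<Sum>b\<in>UNIV. \<Sum>a\<in>UNIV. J a m p * J b i p * rd.G p a b * r i)"
      by (rule sum3_swap23)
    moreover have "\<dots> = (\<Sum>a\<in>UNIV. \<Sum>b\<in>UNIV. \<Sum>i\<in>UNIV. J a m p * J b i p * rd.G p a b * r i)"
      by (rule sum3_swap13)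
    ultimately have "(\<Sum>a\<in>UNIV. (\<Sum>b\<in>UNIV. rd.G p a b * v b) * J a m p) = x m"
      by (simp add: v_def sum_distrib_left sum_distrib_right mult_ac)
    then show ?thesis by (simp add: x left_diff_distrib right_diff_distrib sum_subtractf mult.commute)
  qed
  from J_inj[OF p this] have Gv: "(\<Sum>b\<in>UNIV. rd.G p a b * v b) = y a" for a by simp
  have v: "v b = rd.raise y p b" for b
  proof -
    have "rd.raise y p b = (\<Sum>a\<in>UNIV. rd.H p b a * (\<Sum>s\<in>UNIV. rd.G p a s * v s))" by (simp add: Gv)
    also have "\<dots> = v b" unfolding sum_sum_assoc[symmetric] by (simp add: rd.metric_inv[OF p])
    finally show ?thesis by simp
  qed
  have "(\<Sum>i\<in>UNIV. \<Sum>j\<in>UNIV. rc.H p i j * x i * x j) = (\<Sum>i\<in>UNIV. r i * x i)"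
    using rc.trace_raise[OF p, of x x] by (simp add: r_def mult.assoc)
  also have "\<dots> = (\<Sum>a\<in>UNIV. v a * y a)"
    unfolding x v_def sum_distrib_left sum_distrib_right by (subst sum.swap) (simp add: mult_ac)
  also have "\<dots> = (\<Sum>a\<in>UNIV. \<Sum>b\<in>UNIV. rd.H p a b * y a * y b)"
    using rd.trace_raise[OF p, of y y] by (simp add: v mult.assoc)
  finally show ?thesis .
qed

end

section \<open>Proof of the theorem\<close>

text \<open>Formulated with \<open>Z\<close> instead of \<open>\<sigma>\<close>, as
  \<open>Z_law\<close> compares the vanishing of \<open>Z\<close> in different charts.\<close>

lemma (in wzs_region) Z_zero_nbhd:
  assumes "p \<in> W" "\<forall>k l. Z p k l = 0"
  shows "\<exists>V. open V \<and> p \<in> V \<and> V \<subseteq> W \<and> (\<forall>q\<in>V. \<forall>k l. Z q k l = 0)"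
proof -
  obtain V where V: "open V" "p \<in> V" "V \<subseteq> W" "\<forall>q\<in>V. \<sigma> q = 0"
    using \<sigma>_zero_nbhd[of p] Z_zero_iff[of p] assms by metis
  then have "\<forall>q\<in>V. \<forall>k l. Z q k l = 0" using Z_zero_iff by blast
  with V show ?thesis by blast
qed

lemma (in wzs_region) Z_nonzero_open: "open {q \<in> W. \<exists>k l. Z q k l \<noteq> 0}"
proof -
  have "open (\<sigma> -` (- {0}) \<inter> W)"
    using continuous_on_open_vimage[OF W_open, of \<sigma>] sm_continuous[OF \<sigma>_sm] by blast
  moreover have "\<sigma> -` (- {0}) \<inter> W = {q \<in> W. \<exists>k l. Z q k l \<noteq> 0}"
    using Z_zero_iff by blast
  ultimately show ?thesis by simp
qed

theorem theorem3p2: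
  fixes atlas :: "('a::{t2_space, second_countable_topology}, 'n::finite) chart set"
    and g :: "('a, 'n) tensor02"
    and \<phi> :: "'a \<Rightarrow> real"
    and A B D \<eta> :: "('a, 'n) covector"
  defines "\<eta> \<equiv> covector_diff B D"
  assumes dim: "CARD('n) > 3"
    and manifold: "smooth_atlas atlas"
    and metric: "riemannian_metric atlas g"
    and WZS: "weakly_Z_symmetric atlas g \<phi> A B D"
    and Z_nonzero: "nonzero_on_components atlas (Z_tensor g \<phi>)"
    and eta_nonzero: "nowhere_zero atlas \<eta>"
    and harmonic: "harmonic_conformal_curv atlas g"
    and eta_phi: "\<forall>c\<in>atlas. \<forall>p \<in> dom_chart c. \<forall>j k.
      \<eta> c p j * coord_deriv c k \<phi> p - \<eta> c p k * coord_deriv c j \<phi> p = 0"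
  shows "proper_concircular atlas g (normalized_covector g \<eta>)"
proof -
  have chart: "is_chart c" if "c \<in> atlas" for c
    using manifold that by (simp add: smooth_atlas_def)
  have region: "chart_region c (dom_chart c)" if "c \<in> atlas" for c
    using chart[OF that] by unfold_locales (simp_all add: is_chart_def)
  have g_sm: "smooth_in_chart c (dom_chart c) (\<lambda>q. g c q i j)" if "c \<in> atlas" for c i j
    using metric that by (simp add: riemannian_metric_def smooth_tensor02_field_def)
  have riem: "riemannian_region c (dom_chart c) g" if "c \<in> atlas" for c
    using region[OF that] g_sm[OF that] metric that
    by (simp add: riemannian_region_def riemannian_region_axioms_def riemannian_metric_def)
  have wzs: "wzs_region c (dom_chart c) g \<phi> A B D" if "c \<in> atlas" for c
    using riem[OF that] WZS eta_nonzero that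
    by (simp add: wzs_region_def wzs_region_axioms_def weakly_Z_symmetric_def smooth_scalar_field_def
        smooth_covector_field_def nowhere_zero_def \<eta>_def)
  have transition: "smooth_in_chart c (dom_chart c \<inter> dom_chart d) (\<lambda>q. coords d q $ i)"
    if "c \<in> atlas" "d \<in> atlas" for c d i
    using manifold that by (simp add: smooth_atlas_def)
  have pair: "riemannian_overlap c d (dom_chart c \<inter> dom_chart d) g" if c: "c \<in> atlas" and d: "d \<in> atlas" for c d
  proof -
    let ?W = "dom_chart c \<inter> dom_chart d"
    have "open ?W" using chart[OF c] chart[OF d] by (simp add: is_chart_def open_Int)
    then interpret rc: riemannian_region c ?W g + rd: riemannian_region d ?W g
      using riemannian_region.region_subset_riemannian[OF riem[OF c]]
        riemannian_region.region_subset_riemannian[OF riem[OF d]] by blast+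
    interpret chart_overlap_inverse c d ?W
      by unfold_locales
        (use transition[OF c d] transition[OF d c] in \<open>simp_all add: Int_commute\<close>)
    have "g c p j l = (\<Sum>a\<in>UNIV. \<Sum>b\<in>UNIV. J a j p * J b l p * g d p a b)" if "p \<in> ?W" for p j l
      using metric c d that unfolding riemannian_metric_def smooth_tensor02_field_def J_def by blast
    then show ?thesis by unfold_locales
  qed
  let ?Z = "Z_tensor g \<phi>"
  have Z_transfer: "?Z c q k l = 0"
    if "c \<in> atlas" "d \<in> atlas" "q \<in> dom_chart c" "q \<in> dom_chart d" "\<forall>k l. ?Z d q k l = 0"
    for c d q k l
    using that(3-5) by (subst riemannian_overlap.Z_law[OF pair[OF that(1,2)]]) auto
  have Z_indep: "(\<forall>k l. ?Z c q k l = 0) \<longleftrightarrow> (\<forall>k l. ?Z d q k l = 0)"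
    if "c \<in> atlas" "d \<in> atlas" "q \<in> dom_chart c" "q \<in> dom_chart d" for c d q
    using Z_transfer that by blast
  \<comment> \<open>Propagation of zeros is a global argument, hence the two sets are taken over all
    charts; \<open>Z_indep\<close> makes them disjoint.\<close>
  define N0 where "N0 = {q. \<exists>c\<in>atlas. q \<in> dom_chart c \<and> (\<forall>k l. ?Z c q k l = 0)}"
  define N1 where "N1 = {q. \<exists>c\<in>atlas. q \<in> dom_chart c \<and> (\<exists>k l. ?Z c q k l \<noteq> 0)}"
  have N0_open: "open N0"
  proof (subst open_subopen, rule ballI)
    fix q assume "q \<in> N0"
    then obtain c where c: "c \<in> atlas" "q \<in> dom_chart c" "\<forall>k l. ?Z c q k l = 0"
      by (auto simp: N0_def)
    then obtain V where "open V" "q \<in> V" "V \<subseteq> dom_chart c" "\<forall>x\<in>V. \<forall>k l. ?Z c x k l = 0"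
      using wzs_region.Z_zero_nbhd[OF wzs[OF c(1)]] by meson
    with c(1) show "\<exists>V. open V \<and> q \<in> V \<and> V \<subseteq> N0" unfolding N0_def by blast
  qed
  have N1_open: "open N1"
  proof -
    have "N1 = (\<Union>c\<in>atlas. {q \<in> dom_chart c. \<exists>k l. ?Z c q k l \<noteq> 0})" by (auto simp: N1_def)
    then show ?thesis using wzs_region.Z_nonzero_open[OF wzs] by auto
  qed
  have disjoint: "N0 \<inter> N1 = {}" using Z_indep unfolding N0_def N1_def by blast
  have "\<exists>c\<in>atlas. q \<in> dom_chart c" for q
    using manifold unfolding smooth_atlas_def by blast
  then have cover: "N0 \<union> N1 = UNIV" unfolding N0_def N1_def by blast
  have N1: "p \<in> N1" for p
  proof -
    let ?C = "connected_component_set UNIV p"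
    obtain q where q: "q \<in> ?C" "q \<in> N1"
      using Z_nonzero unfolding nonzero_on_components_def N1_def by blast
    \<comment> \<open>A connected component cannot meet both of two disjoint open sets that cover
      it, and it contains a point of \<open>N1\<close> by \<open>Z_nonzero\<close>.\<close>
    have "N0 \<inter> ?C = {} \<or> N1 \<inter> ?C = {}"
      by (rule connectedD[OF connected_connected_component N0_open N1_open])
        (use disjoint cover in auto)
    moreover have "p \<in> ?C" by simp
    ultimately show ?thesis using q cover by blast
  qed
  have parallel: "nabla_covector g (normalized_covector g \<eta>) c p k l = 0"
    if c: "c \<in> atlas" and p: "p \<in> dom_chart c" for c p k l
  proof -
    interpret wzs_region c "dom_chart c" g \<phi> A B D by (rule wzs[OF c])
    have "\<exists>k l. ?Z c p k l \<noteq> 0" using N1[of p] Z_indep c p unfolding N1_def by blast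
    then have "\<sigma> p \<noteq> 0" using Z_zero_iff[OF p] by blast
    then show ?thesis
      unfolding \<eta>_def
      by (rule normalized_parallel[OF p dim])
        (use harmonic eta_phi c p in \<open>simp_all add: harmonic_conformal_curv_def \<eta>_def\<close>)
  qed
  have "smooth_covector_field atlas (normalized_covector g \<eta>)"
    unfolding smooth_covector_field_def
  proof (intro conjI ballI allI)
    fix c j assume "c \<in> atlas"
    then show "smooth_in_chart c (dom_chart c) (\<lambda>p. normalized_covector g \<eta> c p j)"
      using wzs_region.T_sm[OF wzs] by (simp add: \<eta>_def)
  next
    fix c d p j assume c: "c \<in> atlas" and d: "d \<in> atlas" and p: "p \<in> dom_chart c \<inter> dom_chart d"
    interpret riemannian_overlap c d "dom_chart c \<inter> dom_chart d" g by (rule pair[OF c d])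
    have law: "X c p i = (\<Sum>a\<in>UNIV. J a i p * X d p a)" if "smooth_covector_field atlas X" for X i
      using that c d p unfolding smooth_covector_field_def J_def by blast
    have \<eta>: "\<eta> c p i = (\<Sum>a\<in>UNIV. J a i p * \<eta> d p a)" for i
      using law[of B i] law[of D i] WZS
      by (simp add: weakly_Z_symmetric_def \<eta>_def covector_diff_def right_diff_distrib sum_subtractf)
    \<comment> \<open>The norm is a scalar, so dividing by it preserves the transformation
      law.\<close>
    from norm_square_law[OF p this] have "covector_norm g \<eta> c p = covector_norm g \<eta> d p"
      by (simp add: covector_norm_def)
    then show "normalized_covector g \<eta> c p j
        = (\<Sum>a\<in>UNIV. coord_deriv c j (\<lambda>q. coords d q $ a) p * normalized_covector g \<eta> d p a)"
      by (simp add: normalized_covector_def \<eta>[of j] J_def sum_divide_distrib)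
  qed
  moreover have "smooth_in_chart c (dom_chart c) (\<lambda>_. 0)" if "c \<in> atlas" for c
    by (rule chart_region.sm_const[OF region[OF that]])
  \<comment> \<open>Since the normalized covector is parallel, \<open>\<mu> = 0\<close> and
    \<open>\<rho> = 0\<close> are witnesses.\<close>
  ultimately show ?thesis
    unfolding proper_concircular_def
    by (intro conjI exI[of _ "\<lambda>_ _ _. 0"] exI[of _ "\<lambda>_. 0"])
      (simp_all add: parallel smooth_covector_field_def smooth_scalar_field_def closed_covector_def
        nabla_covector_def[of g "\<lambda>_ _ _. 0"] coord_deriv_def partial_deriv_def o_def)
qed

end
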